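(* Let $\kappa>0$ with $\kappa\neq 8$, let $(B_t)_{t\ge 0}$ be a standard linear Brownian motion, let $(g_t)_{t\ge0}$ be the (forward) Loewner flow driven by $\xi_t=\sqrt\kappa B_t$, and let $\hat f_t(z)=g_t^{-1}(z+\xi_t)$ for $z\in\mathbb H$. Then there exist constants $\varepsilon>0$, $\delta>0$ and $C>0$ such that $$\mathbb P\left[|\hat f_t'(iy)|>y^{-(1-\varepsilon)}\right]\le C y^{2+\delta}$$ for all $t\in[0,1]$ and $y\in(0,1)$.
   Context: $\mathbb H=\{z\in\mathbb C:\Im z>0\}$. For a continuous real-valued function $(\xi_t)_{t\ge0}$, the (forward) Loewner flow driven by $\xi$ is the family $(g_t)_{t\ge 0}$ where, for each $z\in\mathbb H$, $t\mapsto g_t(z)$ is the maximal solution of $dg_t(z)=\frac{2}{g_t(z)-\xi_t}\,dt$, $g_0(z)=z$, defined up to the maximal time $\zeta(z)$ at which $|g_t(z)-\xi_t|\to0$. With $H_t=\{z\in\mathbb H: t<\zeta(z)\}$, the map $g_t$ is a conformal isomorphism from $H_t$ onto $\mathbb H$. The prime denotes the complex derivative in $z$. *)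

theory Defs
  imports "HOL-Probability.Probability" "HOL-Complex_Analysis.Complex_Analysis"
begin

text \<open>All sample paths (not just almost all) are continuous, so that the Loewner flow
  driven by a multiple of any sample path is defined.  Only the times \<open>t \<ge> 0\<close> matter.\<close>

locale standard_brownian_motion = prob_space M
  for M :: "'a measure" +
  fixes B :: "real \<Rightarrow> 'a \<Rightarrow> real"
  assumes random_variable: "\<And>t. 0 \<le> t \<Longrightarrow> B t \<in> borel_measurable M"
    and start_zero: "AE \<omega> in M. B 0 \<omega> = 0"
    and gaussian_increments: "\<And>s t. 0 \<le> s \<Longrightarrow> s < t \<Longrightarrow>
      distributed M lborel (\<lambda>\<omega>. B t \<omega> - B s \<omega>) (normal_density 0 (sqrt (t - s)))"
    and independent_increments: "\<And>(n::nat) \<tau>. 0 \<le> \<tau> 0 \<Longrightarrow> (\<And>i. i < n \<Longrightarrow> \<tau> i < \<tau> (Suc i)) \<Longrightarrow>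
      indep_vars (\<lambda>_. borel) (\<lambda>i \<omega>. B (\<tau> (Suc i)) \<omega> - B (\<tau> i) \<omega>) {..<n}"
    and continuous_paths: "\<And>\<omega>. \<omega> \<in> space M \<Longrightarrow> continuous_on {0..} (\<lambda>t. B t \<omega>)"

definition upper_half_plane :: "complex set"
  where "upper_half_plane = {z. 0 < Im z}"

text \<open>\<open>u\<close> solves the Loewner equation driven by \<open>\<xi>\<close> and started at \<open>z\<close> on the interval \<open>[0, T)\<close>,
  where \<open>T\<close> may be infinite; the values of \<open>u\<close> outside \<open>[0, T)\<close> are irrelevant.\<close>

definition solves_loewner ::
    "(real \<Rightarrow> real) \<Rightarrow> complex \<Rightarrow> ereal \<Rightarrow> (real \<Rightarrow> complex) \<Rightarrow> bool"
  where "solves_loewner \<xi> z T u \<longleftrightarrow> 0 < T \<and> u 0 = z \<and>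
    (\<forall>t\<ge>0. ereal t < T \<longrightarrow> u t \<noteq> of_real (\<xi> t) \<and>
      (u has_vector_derivative 2 / (u t - of_real (\<xi> t))) (at t within {0..}))"

definition loewner_lifetime :: "(real \<Rightarrow> real) \<Rightarrow> complex \<Rightarrow> ereal"
  where "loewner_lifetime \<xi> z = Sup {T. \<exists>u. solves_loewner \<xi> z T u}"

text \<open>Solutions are unique (the vector field is locally Lipschitz in space), so the common
  value at time \<open>t\<close> of all solutions living beyond \<open>t\<close> is the value of the maximal solution.
  It is meaningful only for \<open>0 \<le> t < loewner_lifetime \<xi> z\<close>.\<close>

definition loewner_flow :: "(real \<Rightarrow> real) \<Rightarrow> real \<Rightarrow> complex \<Rightarrow> complex"
  where "loewner_flow \<xi> t z = (THE w. \<exists>T u. ereal t < T \<and> solves_loewner \<xi> z T u \<and> w = u t)"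

definition loewner_domain :: "(real \<Rightarrow> real) \<Rightarrow> real \<Rightarrow> complex set"
  where "loewner_domain \<xi> t = {z \<in> upper_half_plane. ereal t < loewner_lifetime \<xi> z}"

definition loewner_fhat :: "(real \<Rightarrow> real) \<Rightarrow> real \<Rightarrow> complex \<Rightarrow> complex"
  where "loewner_fhat \<xi> t z =
    inv_into (loewner_domain \<xi> t) (loewner_flow \<xi> t) (z + of_real (\<xi> t))"

end

theory Submission
  imports Defs
begin

text \<open>
  The inverse map is the time-\<open>t\<close> value of a Loewner flow run backwards: if \<open>w\<close> solves
  \<open>w' = - 2 / (w - \<xi> (t - s))\<close> with \<open>w 0 = z + \<xi> t\<close>, then \<open>loewner_fhat \<xi> t z = w t\<close>
  (\<open>loewner_fhat_reverse\<close>). The reverse flow increases imaginary parts, so started from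
  \<open>\<i> y\<close> it stays at distance at least \<open>y\<close> from the singularity and never dies.

  For \<open>\<xi> = sqrt \<kappa> * B\<close>, write \<open>Z = w - \<xi>\<close> and let \<open>D\<close> be the derivative of the reverse flow in the
  starting point. The process \<open>\<bar>D\<bar> powr a * (Im Z) powr c * \<bar>Z\<bar> powr (2 * b)\<close> is a local martingale
  for \<open>a = 2 * b + \<kappa> * b * (1 - b) / 2\<close> and \<open>c = - \<kappa> * b\<^sup>2 / 2\<close>. Comparing its expectation at the
  two ends and using \<open>Im Z \<le> \<bar>Z\<bar>\<close> bounds the expectation of
  \<open>\<bar>D\<bar> powr a * (Im Z) powr (c + 2 * b)\<close> by \<open>y powr (c + 2 * b)\<close>
  (\<open>loewner_fhat_moment_bound\<close>).

  The argument for this moment bound replaces Ito's formula by a time discretisation. Along the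
  explicit Euler scheme \<open>Z \<mapsto> Z - 2 * h / Z + sqrt (\<kappa> * h) * N\<close> with \<open>N\<close> standard normal, one step
  multiplies the expected weight by at most \<open>1 + K * (sqrt h / \<bar>Z\<bar>) ^ 3\<close>: the first order term
  vanishes for the above \<open>a\<close> and \<open>c\<close>, and scale invariance makes \<open>K\<close> independent of \<open>Z\<close>
  (\<open>flow_weight_step\<close>). Since \<open>\<bar>Z\<bar> \<ge> y\<close>, the product of the \<open>n\<close> factors with \<open>h = t / n\<close> tends to
  \<open>1\<close>. Up to a translation, the scheme consists of holomorphic maps converging uniformly on each
  half-plane \<open>Im z > y\<close> to the inverse map, so the derivatives converge too (\<open>euler_flow_converges\<close>), and Fatou's lemma
  transfers the bound to the limit.

  The tail estimate is then Markov's inequality. A Schwarz-type bound \<open>\<bar>D\<bar> * y \<le> Im Z\<close> shows that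
  on the event \<open>\<bar>D\<bar> > y powr (- (1 - \<epsilon>))\<close> the imaginary part is at least \<open>y powr \<epsilon>\<close>, while it never
  exceeds \<open>3\<close>; hence the probability is of order \<open>y powr (\<lambda> - O(\<epsilon>))\<close> with
  \<open>\<lambda> = a + c + 2 * b = 4 * b + \<kappa> * b / 2 - \<kappa> * b\<^sup>2\<close>. The best choice \<open>b = (8 + \<kappa>) / (4 * \<kappa>)\<close> gives
  \<open>\<lambda> - 2 = (\<kappa> - 8)\<^sup>2 / (16 * \<kappa>)\<close>, which is positive exactly when \<open>\<kappa> \<noteq> 8\<close>.
\<close>

section \<open>Expansions of real powers\<close>

text \<open>The tail of the binomial series, with \<open>\<bar>u\<bar> ^ k\<close> factored out, converges absolutely at radius
  \<open>1/2\<close>; its value there serves as \<open>K\<close>.\<close>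

lemma powr_taylor_remainder:
  fixes s :: real and k :: nat
  shows "\<exists>K>0. \<forall>u. \<bar>u\<bar> \<le> 1/2 \<longrightarrow>
    \<bar>(1 + u) powr s - (\<Sum>n<k. (s gchoose n) * u ^ n)\<bar> \<le> K * \<bar>u\<bar> ^ k"
proof -
  define c where "c n = (s gchoose n)" for n
  have "summable (\<lambda>n. c n * (3/4) ^ n)"
    using gen_binomial_real[of "3/4" s] unfolding c_def by (simp add: sums_iff)
  then have "summable (\<lambda>n. norm (c n * (1/2) ^ n))"
    by (rule powser_insidea) simp
  then have "summable (\<lambda>n. norm (c (n + k) * (1/2) ^ (n + k)))"
    by (rule summable_ignore_initial_segment)
  then have "summable (\<lambda>n. 2 ^ k * norm (c (n + k) * (1/2) ^ (n + k)))"
    by (rule summable_mult)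
  moreover have "2 ^ k * norm (c (n + k) * (1/2) ^ (n + k)) = \<bar>c (n + k)\<bar> * (1/2) ^ n" for n
    by (simp add: abs_mult power_add power_divide field_simps)
  ultimately have sum: "summable (\<lambda>n. \<bar>c (n + k)\<bar> * (1/2) ^ n)"
    by (simp only:)
  define K where "K = 1 + (\<Sum>n. \<bar>c (n + k)\<bar> * (1/2) ^ n)"
  have K: "K > 0"
    unfolding K_def using suminf_nonneg[OF sum] by (simp add: add_pos_nonneg)
  have "\<bar>(1 + u) powr s - (\<Sum>n<k. c n * u ^ n)\<bar> \<le> K * \<bar>u\<bar> ^ k" if u: "\<bar>u\<bar> \<le> 1/2" for u
  proof -
    have S: "(\<lambda>n. c n * u ^ n) sums (1 + u) powr s"
      using gen_binomial_real[of u s] u unfolding c_def by simp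
    then have "(1 + u) powr s - (\<Sum>n<k. c n * u ^ n) = (\<Sum>n. c (n + k) * u ^ (n + k))"
      using suminf_minus_initial_segment[of "\<lambda>n. c n * u ^ n" k] by (simp add: sums_iff)
    moreover have sm: "summable (\<lambda>n. \<bar>c (n + k)\<bar> * (1/2) ^ n * \<bar>u\<bar> ^ k)"
      by (rule summable_mult2[OF sum])
    moreover have le: "norm (c (n + k) * u ^ (n + k)) \<le> \<bar>c (n + k)\<bar> * (1/2) ^ n * \<bar>u\<bar> ^ k" for n
    proof -
      have "\<bar>u\<bar> ^ n \<le> (1/2) ^ n" by (intro power_mono u) auto
      then show ?thesis
        by (simp add: abs_mult power_add power_abs mult.assoc mult_left_mono mult_right_mono)
    qed
    ultimately have "\<bar>(1 + u) powr s - (\<Sum>n<k. c n * u ^ n)\<bar>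
        \<le> (\<Sum>n. \<bar>c (n + k)\<bar> * (1/2) ^ n * \<bar>u\<bar> ^ k)"
      using norm_suminf_le[OF le sm] by simp
    also have "\<dots> = (\<Sum>n. \<bar>c (n + k)\<bar> * (1/2) ^ n) * \<bar>u\<bar> ^ k"
      by (rule suminf_mult2[OF sum, symmetric])
    also have "\<dots> \<le> K * \<bar>u\<bar> ^ k"
      unfolding K_def by (intro mult_right_mono) auto
    finally show ?thesis .
  qed
  with K show ?thesis unfolding c_def by blast
qed

lemma powr_linear_bound:
  fixes s :: real
  obtains K where "K > 0" "\<And>u. \<bar>u\<bar> \<le> 1/2 \<Longrightarrow> (1 + u) powr s \<le> 1 + s * u + K * u\<^sup>2"
proof -
  from powr_taylor_remainder[of s 2] obtain K where K: "K > 0" and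
    "\<forall>u. \<bar>u\<bar> \<le> 1/2 \<longrightarrow> \<bar>(1 + u) powr s - (\<Sum>n<2. (s gchoose n) * u ^ n)\<bar> \<le> K * \<bar>u\<bar> ^ 2"
    by blast
  then have "(1 + u) powr s \<le> 1 + s * u + K * u\<^sup>2" if "\<bar>u\<bar> \<le> 1/2" for u
    using that by (force simp: numeral_2_eq_2)
  with K that show thesis by blast
qed

text \<open>Away from \<open>0\<close> the expansion is useless, but there \<open>\<bar>u\<bar> ^ 3\<close> is bounded below, so it absorbs both
  the polynomial and the at most polynomial growth of the power. A bound on all of \<open>[-1, \<infinity>)\<close> is
  needed because \<open>u\<close> will depend on an unbounded Gaussian variable.\<close>

lemma powr_quadratic_bound:
  fixes b :: real
  assumes "b \<ge> 0"
  obtains K and m :: nat where "K > 0"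
    "\<And>u. u \<ge> -1 \<Longrightarrow>
      (1 + u) powr b \<le> 1 + b * u + b * (b - 1) / 2 * u\<^sup>2 + K * (\<bar>u\<bar> ^ 3 * (1 + \<bar>u\<bar>) ^ m)"
proof -
  from powr_taylor_remainder[of b 3] obtain K1 where K1: "K1 > 0" and
    T: "\<And>u. \<bar>u\<bar> \<le> 1/2 \<Longrightarrow> \<bar>(1 + u) powr b - (\<Sum>n<3. (b gchoose n) * u ^ n)\<bar> \<le> K1 * \<bar>u\<bar> ^ 3"
    by blast
  define m where "m = nat \<lceil>b\<rceil>"
  have mb: "b \<le> real m" unfolding m_def by linarith
  define K where "K = K1 + 8 + 8 + 4 * \<bar>b\<bar> + 2 * \<bar>b * (b - 1) / 2\<bar>"
  have "(1 + u) powr b \<le> 1 + b * u + b * (b - 1) / 2 * u\<^sup>2 + K * (\<bar>u\<bar> ^ 3 * (1 + \<bar>u\<bar>) ^ m)"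
    if u: "u \<ge> -1" for u
  proof -
    let ?W = "\<bar>u\<bar> ^ 3 * (1 + \<bar>u\<bar>) ^ m"
    have pm: "1 \<le> (1 + \<bar>u\<bar>) ^ m" by (rule one_le_power) simp
    have W3: "\<bar>u\<bar> ^ 3 \<le> ?W" using mult_left_mono[OF pm, of "\<bar>u\<bar> ^ 3"] by simp
    show ?thesis
    proof (cases "\<bar>u\<bar> \<le> 1/2")
      case True
      have "(1 + u) powr b \<le> 1 + b * u + b * (b - 1) / 2 * u\<^sup>2 + K1 * \<bar>u\<bar> ^ 3"
        using T[OF True] gbinomial_Suc[of b 1]
        by (simp add: numeral_3_eq_3 gbinomial_pochhammer' numeral_2_eq_2 pochhammer_Suc abs_le_iff algebra_simps)
      also have "K1 * \<bar>u\<bar> ^ 3 \<le> K1 * ?W" using W3 K1 by (simp add: mult_left_mono)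
      also have "K1 * ?W \<le> K * ?W" unfolding K_def by (intro mult_right_mono) auto
      finally show ?thesis by simp
    next
      case False
      then have u2: "1 \<le> 2 * \<bar>u\<bar>" by simp
      have p1: "1 \<le> 8 * \<bar>u\<bar> ^ 3" using one_le_power[OF u2, of 3] by (simp add: power_mult_distrib)
      have p2: "\<bar>u\<bar> \<le> 4 * \<bar>u\<bar> ^ 3"
        using mult_right_mono[OF one_le_power[OF u2, of 2], of "\<bar>u\<bar>"]
        by (simp add: power_mult_distrib power3_eq_cube power2_eq_square)
      have p3: "\<bar>u\<bar>\<^sup>2 \<le> 2 * \<bar>u\<bar> ^ 3"
        using mult_right_mono[OF u2, of "\<bar>u\<bar>\<^sup>2"] by (simp add: power3_eq_cube power2_eq_square)
      have "(1 + u) powr b \<le> (1 + \<bar>u\<bar>) powr b"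
        using u assms by (intro powr_mono2) auto
      also have "\<dots> \<le> (1 + \<bar>u\<bar>) powr real m" using mb by (intro powr_mono) auto
      also have "\<dots> = 1 * (1 + \<bar>u\<bar>) ^ m" by (subst powr_realpow) auto
      also have "\<dots> \<le> 8 * \<bar>u\<bar> ^ 3 * (1 + \<bar>u\<bar>) ^ m"
        by (intro mult_right_mono p1) auto
      finally have A: "(1 + u) powr b \<le> 8 * ?W" by simp
      have B: "1 \<le> 8 * ?W" using p1 W3 by linarith
      have C: "- (b * u) \<le> 4 * \<bar>b\<bar> * ?W"
      proof -
        have "- (b * u) \<le> \<bar>b\<bar> * \<bar>u\<bar>" by (metis abs_ge_minus_self abs_mult)
        also have "\<dots> \<le> \<bar>b\<bar> * (4 * ?W)" using p2 W3 by (intro mult_left_mono) auto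
        finally show ?thesis by simp
      qed
      have D: "- (b * (b - 1) / 2 * u\<^sup>2) \<le> 2 * \<bar>b * (b - 1) / 2\<bar> * ?W"
      proof -
        have "- (b * (b - 1) / 2 * u\<^sup>2) \<le> \<bar>b * (b - 1) / 2\<bar> * \<bar>u\<^sup>2\<bar>"
          by (metis abs_ge_minus_self abs_mult)
        also have "\<dots> \<le> \<bar>b * (b - 1) / 2\<bar> * (2 * ?W)" using p3 W3 by (intro mult_left_mono) auto
        finally show ?thesis by simp
      qed
      have "0 \<le> K1 * ?W" using K1 by simp
      then show ?thesis using A B C D unfolding K_def distrib_right by linarith
    qed
  qed
  moreover have "K > 0" unfolding K_def using K1 by (simp add: add_pos_nonneg)
  ultimately show thesis using that by blast
qed

text \<open>The error term is kept explicit so that it is uniform in \<open>\<alpha>\<close> and \<open>\<gamma>\<close>. When these cancel, only the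
  error of order \<open>\<rho>\<close> survives.\<close>

lemma expansion_mult:
  fixes \<theta> \<rho> :: real
  assumes "0 \<le> P" "P \<le> 1 + \<alpha> * \<theta> + k1 * \<rho>" "0 \<le> Q" "Q \<le> 1 + \<gamma> * \<theta> + k2 * \<rho>"
    and "\<bar>\<alpha>\<bar> \<le> A" "\<bar>\<gamma>\<bar> \<le> G" "0 \<le> k1" "0 \<le> k2" "0 \<le> \<theta>" "\<theta> \<le> 1" "\<theta>\<^sup>2 \<le> \<rho>" "\<rho> \<le> 1"
  shows "P * Q \<le> 1 + (\<alpha> + \<gamma>) * \<theta> + (A * G + k2 * (1 + A) + k1 * (1 + G) + k1 * k2) * \<rho>"
proof -
  have \<rho>: "0 \<le> \<rho>" using assms(11) zero_le_power2[of \<theta>] by linarith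
  have A: "A \<ge> 0" "G \<ge> 0" using assms by linarith+
  have "P * Q \<le> (1 + \<alpha> * \<theta> + k1 * \<rho>) * (1 + \<gamma> * \<theta> + k2 * \<rho>)"
    using assms by (intro mult_mono) auto
  also have "\<dots> = 1 + (\<alpha> + \<gamma>) * \<theta> + \<alpha> * \<gamma> * \<theta>\<^sup>2 + k2 * \<rho> * (1 + \<alpha> * \<theta>) + k1 * \<rho> * (1 + \<gamma> * \<theta>) + k1 * k2 * \<rho> * \<rho>"
    by (simp add: algebra_simps power2_eq_square)
  also have "\<alpha> * \<gamma> * \<theta>\<^sup>2 \<le> A * G * \<rho>"
  proof -
    have "\<alpha> * \<gamma> \<le> \<bar>\<alpha>\<bar> * \<bar>\<gamma>\<bar>" by (metis abs_ge_self abs_mult)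
    also have "\<dots> \<le> A * G" using assms A by (intro mult_mono) auto
    finally have "\<alpha> * \<gamma> * \<theta>\<^sup>2 \<le> A * G * \<theta>\<^sup>2" by (intro mult_right_mono) auto
    also have "\<dots> \<le> A * G * \<rho>" using assms A by (intro mult_left_mono) auto
    finally show ?thesis .
  qed
  also have "k2 * \<rho> * (1 + \<alpha> * \<theta>) \<le> k2 * \<rho> * (1 + A)"
  proof -
    have "\<alpha> * \<theta> \<le> A * 1" using assms A by (intro mult_mono) auto
    then show ?thesis using assms \<rho> by (intro mult_left_mono) auto
  qed
  also have "k1 * \<rho> * (1 + \<gamma> * \<theta>) \<le> k1 * \<rho> * (1 + G)"
  proof -
    have "\<gamma> * \<theta> \<le> G * 1" using assms A by (intro mult_mono) auto
    then show ?thesis using assms \<rho> by (intro mult_left_mono) auto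
  qed
  also have "k1 * k2 * \<rho> * \<rho> \<le> k1 * k2 * \<rho> * 1"
    using assms \<rho> by (intro mult_left_mono) auto
  finally show ?thesis by (simp add: algebra_simps)
qed

text \<open>The two factors are the growth of \<open>\<bar>D\<bar> powr a\<close> and of \<open>(Im Z) powr c\<close> in one Euler step, where
  \<open>\<theta> = h / \<bar>Z\<bar>\<^sup>2\<close> and \<open>C\<close> is the cosine of twice the argument of \<open>Z\<close>.\<close>

lemma deterministic_factor_bound:
  fixes a c :: real
  obtains K where "K > 0"
    "\<And>\<theta> C. 0 \<le> \<theta> \<Longrightarrow> \<theta> \<le> 1/16 \<Longrightarrow> \<bar>C\<bar> \<le> 1 \<Longrightarrow>
      (1 + 4 * \<theta> * C + 4 * \<theta>\<^sup>2) powr (a/2) * (1 + 2 * \<theta>) powr c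
        \<le> 1 + (2 * a * C + 2 * c) * \<theta> + K * \<theta>\<^sup>2"
proof -
  obtain K1 where K1: "K1 > 0" "\<And>u. \<bar>u\<bar> \<le> 1/2 \<Longrightarrow> (1 + u) powr (a/2) \<le> 1 + a/2 * u + K1 * u\<^sup>2"
    using powr_linear_bound by blast
  obtain K2 where K2: "K2 > 0" "\<And>u. \<bar>u\<bar> \<le> 1/2 \<Longrightarrow> (1 + u) powr c \<le> 1 + c * u + K2 * u\<^sup>2"
    using powr_linear_bound by blast
  define k1 where "k1 = 2 * \<bar>a\<bar> + 25 * K1"
  define k2 where "k2 = 4 * K2"
  define K where "K = 2 * \<bar>a\<bar> * (2 * \<bar>c\<bar>) + k2 * (1 + 2 * \<bar>a\<bar>) + k1 * (1 + 2 * \<bar>c\<bar>) + k1 * k2"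
  have k: "k1 > 0" "k2 > 0" unfolding k1_def k2_def using K1 K2 by (auto simp: add_nonneg_pos)
  show thesis
  proof (rule that[of K])
    show "K > 0" unfolding K_def using k by (simp add: add_nonneg_pos)
    fix \<theta> C :: real assume \<theta>: "0 \<le> \<theta>" "\<theta> \<le> 1/16" and C: "\<bar>C\<bar> \<le> 1"
    have sq: "\<theta>\<^sup>2 \<le> \<theta> / 16" using mult_left_mono[OF \<theta>(2) \<theta>(1)] by (simp add: power2_eq_square)
    define v where "v = 4 * \<theta> * C + 4 * \<theta>\<^sup>2"
    have tC: "\<bar>\<theta> * C\<bar> \<le> \<theta>" using \<theta> C by (simp add: abs_mult mult_left_le)
    have v1: "\<bar>v\<bar> \<le> 5 * \<theta>" unfolding v_def using tC sq \<theta> zero_le_power2[of \<theta>] by linarith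
    have vsq: "v\<^sup>2 \<le> 25 * \<theta>\<^sup>2" using power_mono[OF v1, of 2] by (simp add: power_mult_distrib)
    have "(1 + v) powr (a/2) \<le> 1 + a/2 * v + K1 * v\<^sup>2" using v1 \<theta> by (intro K1) auto
    also have "\<dots> \<le> 1 + a/2 * v + K1 * (25 * \<theta>\<^sup>2)" using vsq K1 by (simp add: mult_left_mono)
    also have "\<dots> \<le> 1 + (2 * a * C) * \<theta> + k1 * \<theta>\<^sup>2"
    proof -
      have "a * \<theta>\<^sup>2 \<le> \<bar>a\<bar> * \<theta>\<^sup>2" by (intro mult_right_mono) auto
      then show ?thesis unfolding v_def k1_def by (simp add: algebra_simps)
    qed
    finally have e1: "(1 + v) powr (a/2) \<le> 1 + (2 * a * C) * \<theta> + k1 * \<theta>\<^sup>2" .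
    have e2: "(1 + 2 * \<theta>) powr c \<le> 1 + (2 * c) * \<theta> + k2 * \<theta>\<^sup>2"
      using K2(2)[of "2 * \<theta>"] \<theta> unfolding k2_def by (simp add: power_mult_distrib algebra_simps)
    have "(1 + v) powr (a/2) * (1 + 2 * \<theta>) powr c \<le> 1 + (2 * a * C + 2 * c) * \<theta> + K * \<theta>\<^sup>2"
      unfolding K_def
    proof (rule expansion_mult[OF _ e1 _ e2])
      show "\<bar>2 * a * C\<bar> \<le> 2 * \<bar>a\<bar>" using C by (simp add: abs_mult mult_left_le)
      show "\<theta>\<^sup>2 \<le> 1" using sq \<theta> by linarith
    qed (use k \<theta> in auto)
    then show "(1 + 4 * \<theta> * C + 4 * \<theta>\<^sup>2) powr (a/2) * (1 + 2 * \<theta>) powr c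
        \<le> 1 + (2 * a * C + 2 * c) * \<theta> + K * \<theta>\<^sup>2" by (simp add: v_def add.assoc)
  qed
qed

section \<open>The Gaussian average of one step\<close>

abbreviation std_gaussian :: "real measure"
  where "std_gaussian \<equiv> density lborel std_normal_density"

lemma prob_space_std_gaussian: "prob_space std_gaussian"
  by (rule prob_space_normal_density) simp

lemma std_gaussian_integral:
  assumes [measurable]: "f \<in> borel_measurable borel"
  shows "integral\<^sup>L std_gaussian f = (\<integral>x. std_normal_density x * f x \<partial>lborel)"
    and "integrable std_gaussian f \<longleftrightarrow> integrable lborel (\<lambda>x. std_normal_density x * f x)"
  by (simp_all add: integral_density integrable_density)

lemma std_gaussian_moments:
  shows "integrable std_gaussian (\<lambda>x. x)" "(\<integral>x. x \<partial>std_gaussian) = 0"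
    and "integrable std_gaussian (\<lambda>x. x\<^sup>2)" "(\<integral>x. x\<^sup>2 \<partial>std_gaussian) = 1"
    and "integrable std_gaussian (\<lambda>x. (1 + x\<^sup>2) ^ p)"
proof -
  have pow: "integrable std_gaussian (\<lambda>x. x ^ k)" for k
    using integrable_std_normal_moment[of k] by (subst std_gaussian_integral(2)) auto
  show "integrable std_gaussian (\<lambda>x. x)" "integrable std_gaussian (\<lambda>x. x\<^sup>2)"
    using pow[of 1] pow[of 2] by simp_all
  show "(\<integral>x. x \<partial>std_gaussian) = 0"
    using integral_std_normal_moment_odd[of 0] by (subst std_gaussian_integral(1)) auto
  show "(\<integral>x. x\<^sup>2 \<partial>std_gaussian) = 1"
    using integral_std_normal_moment_even[of 1] by (subst std_gaussian_integral(1)) (auto simp: fact_numeral)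
  have "(1 + x\<^sup>2) ^ p = (\<Sum>k\<le>p. of_nat (p choose k) * x ^ (2 * (p - k)))" for x :: real
    by (simp add: binomial_ring power_mult)
  then show "integrable std_gaussian (\<lambda>x. (1 + x\<^sup>2) ^ p)"
    using pow by simp
qed

text \<open>The relative change of \<open>\<bar>Z\<bar>\<^sup>2\<close> in one Euler step with Gaussian noise \<open>x\<close> and \<open>s = sqrt \<kappa>\<close>. By scale
  invariance it depends on \<open>Z\<close> and the step size \<open>h\<close> only through \<open>r = sqrt h / \<bar>Z\<bar>\<close> and the cosine
  \<open>q = Re Z / \<bar>Z\<bar>\<close>.\<close>

definition step_ratio :: "real \<Rightarrow> real \<Rightarrow> real \<Rightarrow> real \<Rightarrow> real"
  where "step_ratio s r q x = 2 * s * r * q * (1 - 2 * r\<^sup>2) * x + s\<^sup>2 * r\<^sup>2 * x\<^sup>2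
    - 4 * r\<^sup>2 * (2 * q\<^sup>2 - 1) + 4 * r ^ 4"

text \<open>The ratio is \<open>2 * s * r * q * x\<close> up to terms of size \<open>r\<^sup>2\<close>. All errors of order \<open>r ^ 3\<close> are collected
  with a polynomial weight in \<open>x\<close>, which is integrable against the Gaussian measure.\<close>

lemma step_ratio_powr_pointwise:
  fixes s b :: real
  assumes "b \<ge> 0" "s \<ge> 0"
  obtains K and p :: nat where "K > 0"
    "\<And>r q x. 0 \<le> r \<Longrightarrow> r \<le> 1 \<Longrightarrow> \<bar>q\<bar> \<le> 1 \<Longrightarrow> -1 \<le> step_ratio s r q x \<Longrightarrow>
      (1 + step_ratio s r q x) powr b
        \<le> 1 + 2 * b * s * r * q * (1 - 2 * r\<^sup>2) * x + b * r\<^sup>2 * (s\<^sup>2 * x\<^sup>2 - 4 * (2 * q\<^sup>2 - 1))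
          + 2 * b * (b - 1) * s\<^sup>2 * r\<^sup>2 * q\<^sup>2 * x\<^sup>2 + K * r ^ 3 * (1 + x\<^sup>2) ^ p"
proof -
  obtain K0 and m :: nat where K0: "K0 > 0" and
    Q: "\<And>u. u \<ge> -1 \<Longrightarrow>
      (1 + u) powr b \<le> 1 + b * u + b * (b - 1) / 2 * u\<^sup>2 + K0 * (\<bar>u\<bar> ^ 3 * (1 + \<bar>u\<bar>) ^ m)"
    using powr_quadratic_bound[OF assms(1)] by blast
  define A where "A = 2 * s + s\<^sup>2 + 8"
  define A' where "A' = 4 * s + s\<^sup>2 + 8"
  have A: "A \<ge> 0" "A' \<ge> 0" unfolding A_def A'_def using assms by auto
  define K where "K = 4 * b + \<bar>b * (b - 1) / 2\<bar> * (A' * (4 * s + A')) + K0 * (A ^ 3 * (1 + A) ^ m) + 1"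
  show thesis
  proof (rule that[of K "3 + m"])
    show "K > 0" unfolding K_def using assms A K0 by (simp add: add_nonneg_pos)
    fix r q x :: real
    assume r: "0 \<le> r" "r \<le> 1" and q: "\<bar>q\<bar> \<le> 1" and u: "-1 \<le> step_ratio s r q x"
    define w where "w = 1 + x\<^sup>2"
    define u where "u = step_ratio s r q x"
    \<comment> \<open>the part of the ratio that is of order \<open>r\<^sup>2\<close>\<close>
    define v where "v = u - 2 * s * r * q * x"
    have w1: "w \<ge> 1" unfolding w_def by simp
    have xw: "\<bar>x\<bar> \<le> w"
    proof -
      have "0 \<le> (\<bar>x\<bar> - 1)\<^sup>2" by simp
      then have "2 * \<bar>x\<bar> \<le> 1 + x\<^sup>2" by (simp add: power2_diff)
      then show ?thesis unfolding w_def by linarith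
    qed
    have q2: "\<bar>2 * q\<^sup>2 - 1\<bar> \<le> 1" using q by (simp add: abs_le_iff abs_square_le_1)
    have r2: "r\<^sup>2 \<le> 1" "r\<^sup>2 \<le> r" "r ^ 3 \<le> r\<^sup>2" "r ^ 4 \<le> r ^ 3"
      using r power_decreasing[of 0 2 r] power_decreasing[of 1 2 r] power_decreasing[of 2 3 r]
        power_decreasing[of 3 4 r] by auto
    have r3: "0 \<le> r ^ 3" "0 \<le> r ^ 4" using r by auto
    have qx: "\<bar>q * x\<bar> \<le> w"
      using mult_mono[OF q xw] w1 by (simp add: abs_mult)
    have vb: "\<bar>v\<bar> \<le> A' * r\<^sup>2 * w"
    proof -
      have v: "v = - (4 * s * r ^ 3 * (q * x)) + s\<^sup>2 * r\<^sup>2 * x\<^sup>2 - 4 * r\<^sup>2 * (2 * q\<^sup>2 - 1) + 4 * r ^ 4"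
        unfolding v_def u_def step_ratio_def by (simp add: algebra_simps power2_eq_square power3_eq_cube)
      have "\<bar>4 * s * r ^ 3 * (q * x)\<bar> \<le> 4 * s * r\<^sup>2 * w"
      proof -
        have "\<bar>4 * s * r ^ 3 * (q * x)\<bar> = 4 * s * r ^ 3 * \<bar>q * x\<bar>"
          using assms r by (simp add: abs_mult power_abs)
        also have "\<dots> \<le> 4 * s * r\<^sup>2 * w" using assms r(1) r2(3) qx by (intro mult_mono) auto
        finally show ?thesis .
      qed
      moreover have "\<bar>s\<^sup>2 * r\<^sup>2 * x\<^sup>2\<bar> \<le> s\<^sup>2 * r\<^sup>2 * w"
        unfolding w_def by (simp add: mult_left_mono abs_mult)
      moreover have "\<bar>4 * r\<^sup>2 * (2 * q\<^sup>2 - 1)\<bar> \<le> 4 * r\<^sup>2 * w"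
      proof -
        have "\<bar>4 * r\<^sup>2 * (2 * q\<^sup>2 - 1)\<bar> = 4 * r\<^sup>2 * \<bar>2 * q\<^sup>2 - 1\<bar>" by (simp add: abs_mult)
        also have "\<dots> \<le> 4 * r\<^sup>2 * w" using q2 w1 by (intro mult_left_mono) auto
        finally show ?thesis .
      qed
      moreover have "\<bar>4 * r ^ 4\<bar> \<le> 4 * r\<^sup>2 * w"
      proof -
        have "4 * r ^ 4 \<le> 4 * r\<^sup>2 * 1" using r2 r3 by linarith
        also have "\<dots> \<le> 4 * r\<^sup>2 * w" using w1 by (intro mult_left_mono) auto
        finally show ?thesis using r2 r3 by simp
      qed
      moreover have "A' * r\<^sup>2 * w = 4 * s * r\<^sup>2 * w + s\<^sup>2 * r\<^sup>2 * w + 4 * r\<^sup>2 * w + 4 * r\<^sup>2 * w"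
        unfolding A'_def by (simp add: algebra_simps)
      ultimately show ?thesis unfolding v by linarith
    qed
    have sx: "\<bar>4 * s * r * q * x\<bar> \<le> 4 * s * r * w"
    proof -
      have "\<bar>4 * s * r * q * x\<bar> = 4 * s * r * \<bar>q * x\<bar>" using assms r by (simp add: abs_mult)
      also have "\<dots> \<le> 4 * s * r * w" using assms r qx by (intro mult_left_mono) auto
      finally show ?thesis .
    qed
    have ub: "\<bar>u\<bar> \<le> A * r * w"
    proof -
      have "\<bar>2 * s * r * q * (1 - 2 * r\<^sup>2) * x\<bar> \<le> 2 * s * r * w"
      proof -
        have "\<bar>2 * s * r * q * (1 - 2 * r\<^sup>2) * x\<bar> = 2 * s * r * (\<bar>1 - 2 * r\<^sup>2\<bar> * \<bar>q * x\<bar>)"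
          using assms r by (simp add: abs_mult)
        also have "\<dots> \<le> 2 * s * r * (1 * w)"
          using assms r(1) r2(1) qx w1 by (intro mult_left_mono mult_mono) (auto simp: abs_le_iff)
        finally show ?thesis by simp
      qed
      moreover have "\<bar>s\<^sup>2 * r\<^sup>2 * x\<^sup>2\<bar> \<le> s\<^sup>2 * r * w"
      proof -
        have "\<bar>s\<^sup>2 * r\<^sup>2 * x\<^sup>2\<bar> = s\<^sup>2 * (r\<^sup>2 * x\<^sup>2)" by (simp add: abs_mult)
        also have "\<dots> \<le> s\<^sup>2 * (r * w)"
          unfolding w_def using r r2 by (intro mult_left_mono mult_mono) auto
        finally show ?thesis by simp
      qed
      moreover have "\<bar>4 * r\<^sup>2 * (2 * q\<^sup>2 - 1)\<bar> \<le> 4 * r * w"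
      proof -
        have "\<bar>4 * r\<^sup>2 * (2 * q\<^sup>2 - 1)\<bar> = 4 * r\<^sup>2 * \<bar>2 * q\<^sup>2 - 1\<bar>" by (simp add: abs_mult)
        also have "\<dots> \<le> 4 * r * w" using q2 w1 r r2 by (intro mult_mono) auto
        finally show ?thesis .
      qed
      moreover have "\<bar>4 * r ^ 4\<bar> \<le> 4 * r * w"
      proof -
        have "4 * r ^ 4 \<le> 4 * r * 1" using r2 r3 by linarith
        also have "\<dots> \<le> 4 * r * w" using w1 r by (intro mult_left_mono) auto
        finally show ?thesis using r2 r3 by simp
      qed
      moreover have "A * r * w = 2 * s * r * w + s\<^sup>2 * r * w + 4 * r * w + 4 * r * w"
        unfolding A_def by (simp add: algebra_simps)
      ultimately show ?thesis unfolding u_def step_ratio_def by linarith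
    qed
    have wp: "w ^ i \<le> w ^ (3 + m)" if "i \<le> 3 + m" for i
      using w1 that by (intro power_increasing) auto
    have e1: "b * (4 * r ^ 4) \<le> 4 * b * (r ^ 3 * w ^ (3 + m))"
    proof -
      have "r ^ 3 * 1 \<le> r ^ 3 * w ^ (3 + m)" using r3 wp[of 0] by (intro mult_left_mono) auto
      then have "r ^ 4 \<le> r ^ 3 * w ^ (3 + m)" using r2(4) by linarith
      then show ?thesis using assms by (simp add: mult_left_mono)
    qed
    have e2: "b * (b - 1) / 2 * (u\<^sup>2 - 4 * s\<^sup>2 * r\<^sup>2 * q\<^sup>2 * x\<^sup>2)
        \<le> \<bar>b * (b - 1) / 2\<bar> * (A' * (4 * s + A')) * (r ^ 3 * w ^ (3 + m))"
    proof -
      have "u\<^sup>2 - 4 * s\<^sup>2 * r\<^sup>2 * q\<^sup>2 * x\<^sup>2 = v * (4 * s * r * q * x + v)"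
        unfolding v_def by (simp add: algebra_simps power2_eq_square)
      then have "b * (b - 1) / 2 * (u\<^sup>2 - 4 * s\<^sup>2 * r\<^sup>2 * q\<^sup>2 * x\<^sup>2)
          \<le> \<bar>b * (b - 1) / 2\<bar> * (\<bar>v\<bar> * \<bar>4 * s * r * q * x + v\<bar>)"
        by (metis abs_ge_self abs_mult)
      also have "\<bar>v\<bar> * \<bar>4 * s * r * q * x + v\<bar> \<le> (A' * r\<^sup>2 * w) * ((4 * s + A') * r * w)"
      proof (intro mult_mono vb)
        have "A' * r\<^sup>2 * w \<le> A' * r * w" using r2 r3 A w1 by (intro mult_right_mono mult_left_mono) auto
        then show "\<bar>4 * s * r * q * x + v\<bar> \<le> (4 * s + A') * r * w"
          using sx vb unfolding distrib_right by linarith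
      qed (use A w1 in auto)
      also have "\<dots> = (A' * (4 * s + A')) * (r ^ 3 * w ^ 2)"
        by (simp add: power2_eq_square power3_eq_cube algebra_simps)
      also have "\<dots> \<le> (A' * (4 * s + A')) * (r ^ 3 * w ^ (3 + m))"
        using A assms wp[of 2] r3 by (intro mult_left_mono) auto
      finally show ?thesis by (simp add: mult_left_mono mult.assoc)
    qed
    have e3: "K0 * (\<bar>u\<bar> ^ 3 * (1 + \<bar>u\<bar>) ^ m) \<le> K0 * (A ^ 3 * (1 + A) ^ m) * (r ^ 3 * w ^ (3 + m))"
    proof -
      have "1 + \<bar>u\<bar> \<le> (1 + A) * w"
      proof -
        have "A * r * w \<le> A * 1 * w" using A r w1 by (intro mult_right_mono mult_left_mono) auto
        then show ?thesis using ub w1 unfolding distrib_right by simp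
      qed
      then have "\<bar>u\<bar> ^ 3 * (1 + \<bar>u\<bar>) ^ m \<le> (A * r * w) ^ 3 * ((1 + A) * w) ^ m"
        using ub A r w1 by (intro mult_mono power_mono) auto
      also have "\<dots> = (A ^ 3 * (1 + A) ^ m) * (r ^ 3 * w ^ (3 + m))"
        unfolding power_mult_distrib power_add by (simp only: mult_ac)
      finally show ?thesis using K0 by (simp add: mult_left_mono mult.assoc)
    qed
    have nn: "0 \<le> r ^ 3 * w ^ (3 + m)" by (intro mult_nonneg_nonneg r3 zero_le_power) (use w1 in auto)
    have lin: "b * u = 2 * b * s * r * q * (1 - 2 * r\<^sup>2) * x + b * r\<^sup>2 * (s\<^sup>2 * x\<^sup>2 - 4 * (2 * q\<^sup>2 - 1)) + b * (4 * r ^ 4)"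
      unfolding u_def step_ratio_def by (simp add: algebra_simps)
    have quad: "b * (b - 1) / 2 * u\<^sup>2 = 2 * b * (b - 1) * s\<^sup>2 * r\<^sup>2 * q\<^sup>2 * x\<^sup>2
        + b * (b - 1) / 2 * (u\<^sup>2 - 4 * s\<^sup>2 * r\<^sup>2 * q\<^sup>2 * x\<^sup>2)"
      by (simp add: field_simps)
    have Ke: "K * r ^ 3 * w ^ (3 + m) = 4 * b * (r ^ 3 * w ^ (3 + m))
        + \<bar>b * (b - 1) / 2\<bar> * (A' * (4 * s + A')) * (r ^ 3 * w ^ (3 + m))
        + K0 * (A ^ 3 * (1 + A) ^ m) * (r ^ 3 * w ^ (3 + m)) + r ^ 3 * w ^ (3 + m)"
      unfolding K_def by (simp only: distrib_right mult.assoc mult_1_left)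
    have "(1 + u) powr b \<le> 1 + b * u + b * (b - 1) / 2 * u\<^sup>2 + K0 * (\<bar>u\<bar> ^ 3 * (1 + \<bar>u\<bar>) ^ m)"
      using Q u unfolding u_def by blast
    also have "\<dots> \<le> 1 + 2 * b * s * r * q * (1 - 2 * r\<^sup>2) * x + b * r\<^sup>2 * (s\<^sup>2 * x\<^sup>2 - 4 * (2 * q\<^sup>2 - 1))
          + 2 * b * (b - 1) * s\<^sup>2 * r\<^sup>2 * q\<^sup>2 * x\<^sup>2 + K * r ^ 3 * w ^ (3 + m)"
      using e1 e2 e3 nn unfolding lin quad Ke by linarith
    finally show "(1 + step_ratio s r q x) powr b
        \<le> 1 + 2 * b * s * r * q * (1 - 2 * r\<^sup>2) * x + b * r\<^sup>2 * (s\<^sup>2 * x\<^sup>2 - 4 * (2 * q\<^sup>2 - 1))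
          + 2 * b * (b - 1) * s\<^sup>2 * r\<^sup>2 * q\<^sup>2 * x\<^sup>2 + K * r ^ 3 * (1 + x\<^sup>2) ^ (3 + m)"
      unfolding u_def w_def .
  qed
qed

text \<open>Averaging the pointwise bound: the term linear in \<open>x\<close> has mean zero and \<open>x\<^sup>2\<close> has mean one. This
  is the discrete form of the Ito correction.\<close>

lemma step_ratio_powr_expectation:
  fixes s b :: real
  assumes "b \<ge> 0" "s \<ge> 0"
  obtains K where "K > 0"
    "\<And>r q. 0 \<le> r \<Longrightarrow> r \<le> 1 \<Longrightarrow> \<bar>q\<bar> \<le> 1 \<Longrightarrow> (\<And>x. -1 \<le> step_ratio s r q x) \<Longrightarrow>
      \<exists>Q\<ge>0. (\<integral>\<^sup>+ x. ennreal ((1 + step_ratio s r q x) powr b) \<partial>std_gaussian) \<le> ennreal Q \<and>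
        Q \<le> 1 + (b * (s\<^sup>2 - 4 * (2 * q\<^sup>2 - 1)) + 2 * b * (b - 1) * s\<^sup>2 * q\<^sup>2) * r\<^sup>2 + K * r ^ 3"
proof -
  obtain K and p :: nat where K: "K > 0" and
    B: "\<And>r q x. 0 \<le> r \<Longrightarrow> r \<le> 1 \<Longrightarrow> \<bar>q\<bar> \<le> 1 \<Longrightarrow> -1 \<le> step_ratio s r q x \<Longrightarrow>
      (1 + step_ratio s r q x) powr b
        \<le> 1 + 2 * b * s * r * q * (1 - 2 * r\<^sup>2) * x + b * r\<^sup>2 * (s\<^sup>2 * x\<^sup>2 - 4 * (2 * q\<^sup>2 - 1))
          + 2 * b * (b - 1) * s\<^sup>2 * r\<^sup>2 * q\<^sup>2 * x\<^sup>2 + K * r ^ 3 * (1 + x\<^sup>2) ^ p"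
    using step_ratio_powr_pointwise[OF assms] by metis
  interpret prob_space std_gaussian by (rule prob_space_std_gaussian)
  define G where "G = (\<integral>x. (1 + x\<^sup>2) ^ p \<partial>std_gaussian)"
  have G0: "G \<ge> 0" unfolding G_def by simp
  note [simp] = std_gaussian_moments
  show thesis
  proof (rule that[of "K * G + 1"])
    show "K * G + 1 > 0" using K G0 by (simp add: add_nonneg_pos)
    fix r q :: real
    assume r: "0 \<le> r" "r \<le> 1" and q: "\<bar>q\<bar> \<le> 1" and u: "\<And>x. -1 \<le> step_ratio s r q x"
    define f where "f x = 1 + (2 * b * s * r * q * (1 - 2 * r\<^sup>2)) * x + (b * r\<^sup>2 * (s\<^sup>2 * x\<^sup>2 - 4 * (2 * q\<^sup>2 - 1)))
          + (2 * b * (b - 1) * s\<^sup>2 * r\<^sup>2 * q\<^sup>2) * x\<^sup>2 + K * r ^ 3 * (1 + x\<^sup>2) ^ p" for x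
    have le: "(1 + step_ratio s r q x) powr b \<le> f x" for x
      using B[OF r q u] unfolding f_def by simp
    have f0: "f x \<ge> 0" for x using le[of x] powr_ge_zero[of "1 + step_ratio s r q x" b] by linarith
    have fi: "integrable std_gaussian f" unfolding f_def by simp
    have "(\<integral>\<^sup>+ x. ennreal ((1 + step_ratio s r q x) powr b) \<partial>std_gaussian) \<le> (\<integral>\<^sup>+ x. ennreal (f x) \<partial>std_gaussian)"
      using le by (intro nn_integral_mono ennreal_leI) 
    also have "\<dots> = ennreal (integral\<^sup>L std_gaussian f)"
      using f0 by (intro nn_integral_eq_integral fi) auto
    finally have 1: "(\<integral>\<^sup>+ x. ennreal ((1 + step_ratio s r q x) powr b) \<partial>std_gaussian) \<le> ennreal (integral\<^sup>L std_gaussian f)" .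
    have "integral\<^sup>L std_gaussian f = 1 + b * r\<^sup>2 * (s\<^sup>2 - 4 * (2 * q\<^sup>2 - 1))
          + 2 * b * (b - 1) * s\<^sup>2 * r\<^sup>2 * q\<^sup>2 + K * r ^ 3 * G"
      unfolding f_def G_def using prob_space by (simp add: prob_space)
    also have "\<dots> \<le> 1 + (b * (s\<^sup>2 - 4 * (2 * q\<^sup>2 - 1)) + 2 * b * (b - 1) * s\<^sup>2 * q\<^sup>2) * r\<^sup>2 + (K * G + 1) * r ^ 3"
      using r by (simp add: algebra_simps)
    finally show "\<exists>Q\<ge>0. (\<integral>\<^sup>+ x. ennreal ((1 + step_ratio s r q x) powr b) \<partial>std_gaussian) \<le> ennreal Q \<and>
        Q \<le> 1 + (b * (s\<^sup>2 - 4 * (2 * q\<^sup>2 - 1)) + 2 * b * (b - 1) * s\<^sup>2 * q\<^sup>2) * r\<^sup>2 + (K * G + 1) * r ^ 3"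
      using 1 f0 by (intro exI[of _ "integral\<^sup>L std_gaussian f"]) auto
  qed
qed

section \<open>The discretised reverse flow\<close>

text \<open>One Euler step in polar-type coordinates: each quantity entering the weight is multiplied by a
  factor that depends on \<open>r\<close>, \<open>q\<close> and the noise alone.\<close>

lemma euler_step_geometry:
  fixes Z :: complex and h s x :: real
  assumes Z: "Z \<noteq> 0" and h: "h \<ge> 0"
  defines "r \<equiv> sqrt h / cmod Z" and "q \<equiv> Re Z / cmod Z"
  shows "(cmod (1 + 2 * of_real h / Z\<^sup>2))\<^sup>2 = 1 + 4 * r\<^sup>2 * (2 * q\<^sup>2 - 1) + 4 * (r\<^sup>2)\<^sup>2"
    and "Im (Z - 2 * of_real h / Z + of_real x) = Im Z * (1 + 2 * r\<^sup>2)"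
    and "(cmod (Z - 2 * of_real h / Z + of_real (s * sqrt h * x)))\<^sup>2 = (cmod Z)\<^sup>2 * (1 + step_ratio s r q x)"
proof -
  define X Y R where "X = Re Z" and "Y = Im Z" and "R = (cmod Z)\<^sup>2"
  have R: "R = X\<^sup>2 + Y\<^sup>2" unfolding R_def X_def Y_def by (simp add: cmod_power2)
  have R0: "R > 0" unfolding R_def using Z by simp
  have r2: "r\<^sup>2 = h / R" unfolding r_def R_def using h by (simp add: power_divide)
  have q2: "q\<^sup>2 = X\<^sup>2 / R" unfolding q_def R_def X_def by (simp add: power_divide)
  have hZ: "of_real h / Z = Complex (h * X / R) (- (h * Y / R))"
    unfolding X_def Y_def R_def by (simp add: complex_eq_iff Re_divide Im_divide cmod_power2)
  have q1: "(2 * q\<^sup>2 - 1) * R = X\<^sup>2 - Y\<^sup>2" 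
  proof -
    have "(2 * q\<^sup>2 - 1) * R = 2 * (q\<^sup>2 * R) - R" by (simp add: algebra_simps)
    also have "q\<^sup>2 * R = X\<^sup>2" using R0 unfolding q2 by simp
    finally show ?thesis unfolding R by simp
  qed
  show "(cmod (1 + 2 * of_real h / Z\<^sup>2))\<^sup>2 = 1 + 4 * r\<^sup>2 * (2 * q\<^sup>2 - 1) + 4 * (r\<^sup>2)\<^sup>2"
  proof -
    have "1 + 2 * of_real h / Z\<^sup>2 = (Z\<^sup>2 + 2 * of_real h) / Z\<^sup>2" using Z by (simp add: field_simps)
    then have "(cmod (1 + 2 * of_real h / Z\<^sup>2))\<^sup>2 = (cmod (Z\<^sup>2 + 2 * of_real h))\<^sup>2 / R\<^sup>2"
      unfolding R_def by (simp add: norm_divide norm_power power_divide)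
    also have "(cmod (Z\<^sup>2 + 2 * of_real h))\<^sup>2 = (X\<^sup>2 - Y\<^sup>2 + 2 * h)\<^sup>2 + (2 * X * Y)\<^sup>2"
      unfolding cmod_power2 X_def Y_def by (simp add: power2_eq_square)
    also have "\<dots> = R\<^sup>2 + 4 * h * (X\<^sup>2 - Y\<^sup>2) + 4 * h\<^sup>2"
      unfolding R by (simp add: power2_eq_square algebra_simps)
    also have "\<dots> = R\<^sup>2 + 4 * h * ((2 * q\<^sup>2 - 1) * R) + 4 * h\<^sup>2" unfolding q1 by simp
    also have "\<dots> / R\<^sup>2 = 1 + 4 * r\<^sup>2 * (2 * q\<^sup>2 - 1) + 4 * (r\<^sup>2)\<^sup>2"
      unfolding r2 using R0 by (simp add: field_simps power2_eq_square)
    finally show ?thesis .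
  qed
  have im: "Im (Z - 2 * of_real h / Z + of_real y) = Im Z * (1 + 2 * r\<^sup>2)" for y
  proof -
    have "Im (Z - 2 * of_real h / Z + of_real y) = Y - 2 * Im (of_real h / Z)"
      unfolding Y_def by (simp flip: times_divide_eq_right)
    then show ?thesis unfolding hZ r2 Y_def by (simp add: algebra_simps)
  qed
  then show "Im (Z - 2 * of_real h / Z + of_real x) = Im Z * (1 + 2 * r\<^sup>2)" .
  show "(cmod (Z - 2 * of_real h / Z + of_real (s * sqrt h * x)))\<^sup>2 = (cmod Z)\<^sup>2 * (1 + step_ratio s r q x)"
  proof -
    define w where "w = s * sqrt h * x"
    have re: "Re (Z - 2 * of_real h / Z + of_real w) = X * (1 - 2 * r\<^sup>2) + w"
    proof -
      have "Re (Z - 2 * of_real h / Z + of_real w) = X - 2 * Re (of_real h / Z) + w"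
        unfolding X_def by (simp flip: times_divide_eq_right)
      then show ?thesis unfolding hZ r2 by (simp add: algebra_simps)
    qed
    have cZ: "cmod Z > 0" using Z by simp
    have w: "w = s * r * x * cmod Z" unfolding w_def r_def using cZ by simp
    have X: "X = q * cmod Z" unfolding q_def X_def using cZ by simp
    have Y2: "Y\<^sup>2 = (1 - q\<^sup>2) * R"
      using R unfolding X R_def by (simp add: power_mult_distrib algebra_simps)
    have "(cmod (Z - 2 * of_real h / Z + of_real w))\<^sup>2 = (X * (1 - 2 * r\<^sup>2) + w)\<^sup>2 + Y\<^sup>2 * (1 + 2 * r\<^sup>2)\<^sup>2"
      unfolding cmod_power2 re im Y_def by (simp add: power_mult_distrib)
    also have "X * (1 - 2 * r\<^sup>2) + w = (q * (1 - 2 * r\<^sup>2) + s * r * x) * cmod Z"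
      unfolding X w by (simp add: algebra_simps)
    also have "((q * (1 - 2 * r\<^sup>2) + s * r * x) * cmod Z)\<^sup>2 + Y\<^sup>2 * (1 + 2 * r\<^sup>2)\<^sup>2
        = R * ((q * (1 - 2 * r\<^sup>2) + s * r * x)\<^sup>2 + (1 - q\<^sup>2) * (1 + 2 * r\<^sup>2)\<^sup>2)"
      unfolding Y2 R_def power_mult_distrib by (simp only: distrib_left mult_ac)
    also have "(q * (1 - 2 * r\<^sup>2) + s * r * x)\<^sup>2 + (1 - q\<^sup>2) * (1 + 2 * r\<^sup>2)\<^sup>2 = 1 + step_ratio s r q x"
      unfolding step_ratio_def by (simp add: power2_eq_square algebra_simps power4_eq_xxxx)
    finally show ?thesis unfolding w_def R_def .
  qed
qed

text \<open>Evaluated along the reverse flow, this is the local martingale of the introduction; \<open>D\<close> stands for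
  the spatial derivative of the flow and \<open>Z\<close> for its position relative to the driving point.\<close>

definition flow_weight :: "real \<Rightarrow> real \<Rightarrow> real \<Rightarrow> complex \<Rightarrow> complex \<Rightarrow> real"
  where "flow_weight a c b D Z = cmod D powr a * Im Z powr c * (cmod Z)\<^sup>2 powr b"

lemma flow_weight_nonneg: "flow_weight a c b D Z \<ge> 0"
  unfolding flow_weight_def by simp

lemma powr_half_of_square:
  fixes x a :: real
  assumes "x \<ge> 0"
  shows "x\<^sup>2 powr (a / 2) = x powr a"
  using assms by (cases "x = 0") (auto simp: powr_powr simp flip: powr_numeral)

text \<open>The deterministic growth of \<open>\<bar>D\<bar>\<close> and \<open>Im Z\<close> and the averaged growth of \<open>\<bar>Z\<bar>\<close> have opposite first
  order coefficients. This cancellation, for every direction of \<open>Z\<close>, is what determines \<open>a\<close> and \<open>c\<close>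
  in terms of \<open>b\<close>. The condition \<open>16 * h \<le> \<bar>Z\<bar>\<^sup>2\<close> keeps the step within the range of the expansions.\<close>

lemma flow_weight_step:
  fixes \<kappa> b :: real
  assumes "\<kappa> \<ge> 0" "b \<ge> 0"
  defines "a \<equiv> 2 * b + \<kappa> * b * (1 - b) / 2" and "c \<equiv> - \<kappa> * b\<^sup>2 / 2"
  obtains K where "K > 0"
    "\<And>h D Z. 0 \<le> h \<Longrightarrow> 0 < Im Z \<Longrightarrow> 16 * h \<le> (cmod Z)\<^sup>2 \<Longrightarrow>
      (\<integral>\<^sup>+ x. ennreal (flow_weight a c b (D * (1 + 2 * of_real h / Z\<^sup>2))
          (Z - 2 * of_real h / Z + of_real (sqrt \<kappa> * sqrt h * x))) \<partial>std_gaussian)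
        \<le> ennreal (flow_weight a c b D Z * (1 + K * (sqrt h / cmod Z) ^ 3))"
proof -
  define s where "s = sqrt \<kappa>"
  have s: "s \<ge> 0" "s\<^sup>2 = \<kappa>" unfolding s_def using assms by auto
  obtain K1 where K1: "K1 > 0" and E1:
    "\<And>\<theta> C. 0 \<le> \<theta> \<Longrightarrow> \<theta> \<le> 1/16 \<Longrightarrow> \<bar>C\<bar> \<le> 1 \<Longrightarrow>
      (1 + 4 * \<theta> * C + 4 * \<theta>\<^sup>2) powr (a/2) * (1 + 2 * \<theta>) powr c
        \<le> 1 + (2 * a * C + 2 * c) * \<theta> + K1 * \<theta>\<^sup>2"
    using deterministic_factor_bound[of a c] by blast
  obtain K2 where K2: "K2 > 0" and E2:
    "\<And>r q. 0 \<le> r \<Longrightarrow> r \<le> 1 \<Longrightarrow> \<bar>q\<bar> \<le> 1 \<Longrightarrow> (\<And>x. -1 \<le> step_ratio s r q x) \<Longrightarrow>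
      \<exists>Q\<ge>0. (\<integral>\<^sup>+ x. ennreal ((1 + step_ratio s r q x) powr b) \<partial>std_gaussian) \<le> ennreal Q \<and>
        Q \<le> 1 + (b * (s\<^sup>2 - 4 * (2 * q\<^sup>2 - 1)) + 2 * b * (b - 1) * s\<^sup>2 * q\<^sup>2) * r\<^sup>2 + K2 * r ^ 3"
    using step_ratio_powr_expectation[OF assms(2) s(1)] by metis
  define A where "A = 2 * \<bar>a\<bar> + 2 * \<bar>c\<bar>"
  define K where "K = A * A + K2 * (1 + A) + K1 * (1 + A) + K1 * K2"
  have A: "A \<ge> 0" unfolding A_def by simp
  show thesis
  proof (rule that[of K])
    show "K > 0" unfolding K_def using A K1 K2 by (intro add_nonneg_pos) auto
    fix h D Z assume h: "0 \<le> h" and Z: "0 < Im Z" and hZ: "16 * h \<le> (cmod Z)\<^sup>2"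
    define r where "r = sqrt h / cmod Z"
    define q where "q = Re Z / cmod Z"
    define \<theta> where "\<theta> = r\<^sup>2"
    have Z0: "Z \<noteq> 0" using Z by auto
    then have cZ: "cmod Z > 0" by simp
    have r0: "0 \<le> r" unfolding r_def using h by simp
    have "\<theta> = h / (cmod Z)\<^sup>2" unfolding \<theta>_def r_def using h by (simp add: power_divide)
    moreover have "0 < (cmod Z)\<^sup>2" using cZ by simp
    ultimately have \<theta>: "0 \<le> \<theta>" "\<theta> \<le> 1/16"
      using h hZ by (simp_all add: pos_divide_le_eq)
    have r1: "r \<le> 1" using \<theta>(2) r0 power2_le_imp_le[of r 1] unfolding \<theta>_def by simp
    have q: "\<bar>q\<bar> \<le> 1" unfolding q_def using abs_Re_le_cmod[of Z] cZ by (simp add: abs_divide)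
    define C where "C = 2 * q\<^sup>2 - 1"
    have C: "\<bar>C\<bar> \<le> 1" using q unfolding C_def by (simp add: abs_le_iff abs_square_le_1)
    note geo = euler_step_geometry[OF Z0 h, folded r_def q_def]
    have sr: "-1 \<le> step_ratio s r q x" for x
    proof -
      have "0 \<le> (cmod Z)\<^sup>2 * (1 + step_ratio s r q x)" unfolding geo(3)[symmetric] by simp
      then show ?thesis using cZ by (simp add: zero_le_mult_iff)
    qed
    define P where "P = (1 + 4 * \<theta> * C + 4 * \<theta>\<^sup>2) powr (a/2) * (1 + 2 * \<theta>) powr c"
    have P: "0 \<le> P" "P \<le> 1 + (2 * a * C + 2 * c) * \<theta> + K1 * \<theta>\<^sup>2"
      using E1[OF \<theta> C] unfolding P_def by simp_all
    obtain Q where Q0: "Q \<ge> 0" and Q1: "(\<integral>\<^sup>+ x. ennreal ((1 + step_ratio s r q x) powr b) \<partial>std_gaussian) \<le> ennreal Q"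
      and Q2: "Q \<le> 1 + (b * (s\<^sup>2 - 4 * C) + 2 * b * (b - 1) * s\<^sup>2 * q\<^sup>2) * \<theta> + K2 * r ^ 3"
      using E2[OF r0 r1 q sr] unfolding C_def \<theta>_def by blast
    \<comment> \<open>the vanishing drift, with \<open>C = 2 * q\<^sup>2 - 1\<close>\<close>
    have canc: "b * (s\<^sup>2 - 4 * C) + 2 * b * (b - 1) * s\<^sup>2 * q\<^sup>2 = - (2 * a * C + 2 * c)"
      unfolding s(2) a_def c_def C_def by (simp add: field_simps power2_eq_square)
    have PQ: "P * Q \<le> 1 + K * r ^ 3"
    proof -
      have bd: "\<bar>2 * a * C + 2 * c\<bar> \<le> A"
      proof -
        have "\<bar>2 * a * C + 2 * c\<bar> \<le> 2 * \<bar>a\<bar> * \<bar>C\<bar> + 2 * \<bar>c\<bar>" 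
          using abs_triangle_ineq[of "2 * a * C" "2 * c"] by (simp add: abs_mult)
        also have "2 * \<bar>a\<bar> * \<bar>C\<bar> \<le> 2 * \<bar>a\<bar> * 1" using C by (intro mult_left_mono) auto
        finally show ?thesis unfolding A_def by simp
      qed
      have t: "\<theta>\<^sup>2 \<le> r ^ 3" "r ^ 3 \<le> 1" 
        using r0 r1 power_decreasing[of 3 4 r] power_le_one[of r 3] unfolding \<theta>_def by (simp_all add: power_mult[symmetric])
      have "K1 * \<theta>\<^sup>2 \<le> K1 * r ^ 3" using t K1 by simp
      then have P': "P \<le> 1 + (2 * a * C + 2 * c) * \<theta> + K1 * r ^ 3" using P(2) by linarith
      have "P * Q \<le> 1 + ((2 * a * C + 2 * c) + (- (2 * a * C + 2 * c))) * \<theta> + K * r ^ 3"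
        unfolding K_def
        by (rule expansion_mult[OF P(1) P' Q0 Q2[unfolded canc] bd]) (use bd K1 K2 \<theta> t in auto)
      then show ?thesis by simp
    qed
    have eq: "flow_weight a c b (D * (1 + 2 * of_real h / Z\<^sup>2)) (Z - 2 * of_real h / Z + of_real (s * sqrt h * x))
        = flow_weight a c b D Z * P * (1 + step_ratio s r q x) powr b" for x
    proof -
      have "cmod (1 + 2 * of_real h / Z\<^sup>2) powr a = ((cmod (1 + 2 * of_real h / Z\<^sup>2))\<^sup>2) powr (a/2)"
        by (simp add: powr_half_of_square)
      also have "\<dots> = (1 + 4 * \<theta> * C + 4 * \<theta>\<^sup>2) powr (a/2)" unfolding geo(1) \<theta>_def C_def ..
      finally have 1: "cmod (1 + 2 * of_real h / Z\<^sup>2) powr a = (1 + 4 * \<theta> * C + 4 * \<theta>\<^sup>2) powr (a/2)" .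
      have 2: "(Im Z * (1 + 2 * \<theta>)) powr c = Im Z powr c * (1 + 2 * \<theta>) powr c"
        using Z \<theta> by (simp add: powr_mult)
      have 3: "((cmod Z)\<^sup>2 * (1 + step_ratio s r q x)) powr b = (cmod Z)\<^sup>2 powr b * (1 + step_ratio s r q x) powr b"
        using sr[of x] by (simp add: powr_mult)
      show ?thesis
        unfolding flow_weight_def geo(2,3) norm_mult 3 2[unfolded \<theta>_def] P_def
        by (simp add: powr_mult 1 \<theta>_def)
    qed
    have "(\<integral>\<^sup>+ x. ennreal (flow_weight a c b (D * (1 + 2 * of_real h / Z\<^sup>2))
          (Z - 2 * of_real h / Z + of_real (s * sqrt h * x))) \<partial>std_gaussian)
      = (\<integral>\<^sup>+ x. ennreal (flow_weight a c b D Z * P) * ennreal ((1 + step_ratio s r q x) powr b) \<partial>std_gaussian)"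
      unfolding eq using P(1) flow_weight_nonneg by (simp add: ennreal_mult)
    also have "\<dots> = ennreal (flow_weight a c b D Z * P) * (\<integral>\<^sup>+ x. ennreal ((1 + step_ratio s r q x) powr b) \<partial>std_gaussian)"
      unfolding step_ratio_def by (intro nn_integral_cmult) simp
    also have "\<dots> \<le> ennreal (flow_weight a c b D Z * P) * ennreal Q"
      by (intro mult_left_mono Q1) simp
    also have "\<dots> = ennreal (flow_weight a c b D Z * (P * Q))"
      using P(1) flow_weight_nonneg Q0 by (simp add: ennreal_mult[symmetric] mult.assoc)
    also have "\<dots> \<le> ennreal (flow_weight a c b D Z * (1 + K * r ^ 3))"
      by (intro ennreal_leI mult_left_mono PQ flow_weight_nonneg)
    finally show "(\<integral>\<^sup>+ x. ennreal (flow_weight a c b (D * (1 + 2 * of_real h / Z\<^sup>2))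
          (Z - 2 * of_real h / Z + of_real (sqrt \<kappa> * sqrt h * x))) \<partial>std_gaussian)
        \<le> ennreal (flow_weight a c b D Z * (1 + K * (sqrt h / cmod Z) ^ 3))"
      unfolding s_def r_def .
  qed
qed

text \<open>Explicit Euler scheme for the reverse flow seen from the driving point: drift \<open>- 2 / Z\<close> during a time
  \<open>h\<close>, followed by the displacement \<open>x k\<close> of the driving point. Translations do not affect the
  derivative in the starting point, which is therefore the product in \<open>euler_deriv\<close>.\<close>

primrec euler_flow :: "real \<Rightarrow> (nat \<Rightarrow> real) \<Rightarrow> complex \<Rightarrow> nat \<Rightarrow> complex"
  where
    "euler_flow h x z 0 = z"
  | "euler_flow h x z (Suc k) =
      euler_flow h x z k - 2 * of_real h / euler_flow h x z k + of_real (x k)"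

primrec euler_deriv :: "real \<Rightarrow> (nat \<Rightarrow> real) \<Rightarrow> complex \<Rightarrow> nat \<Rightarrow> complex"
  where
    "euler_deriv h x z 0 = 1"
  | "euler_deriv h x z (Suc k) =
      euler_deriv h x z k * (1 + 2 * of_real h / (euler_flow h x z k)\<^sup>2)"

lemma Im_euler_flow_Suc:
  assumes "0 \<le> h" "0 < Im (euler_flow h x z k)"
  shows "Im (euler_flow h x z (Suc k)) =
    Im (euler_flow h x z k) * (1 + 2 * h / (cmod (euler_flow h x z k))\<^sup>2)"
proof -
  have "euler_flow h x z k \<noteq> 0" using assms by auto
  from euler_step_geometry(2)[OF this assms(1)] show ?thesis
    using assms by (simp add: power_divide)
qed

lemma Im_euler_flow_ge:
  assumes "0 \<le> h" "0 < Im z"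
  shows "Im z \<le> Im (euler_flow h x z k)"
proof (induction k)
  case (Suc k)
  then have pos: "0 < Im (euler_flow h x z k)" using assms by linarith
  then have "Im (euler_flow h x z k) * 1 \<le> Im (euler_flow h x z (Suc k))"
    unfolding Im_euler_flow_Suc[OF assms(1) pos] using assms by (intro mult_left_mono) auto
  with Suc show ?case by linarith
qed simp

lemma euler_flow_nonzero:
  assumes "0 \<le> h" "0 < Im z"
  shows "euler_flow h x z k \<noteq> 0"
  using Im_euler_flow_ge[OF assms, of x k] assms by auto

lemma norm_euler_flow_ge:
  assumes "0 \<le> h" "0 < Im z"
  shows "Im z \<le> cmod (euler_flow h x z k)"
  using Im_euler_flow_ge[OF assms, of x k] abs_Im_le_cmod[of "euler_flow h x z k"] by linarith

lemma has_field_derivative_euler_flow: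
  assumes "0 \<le> h" "0 < Im z"
  shows "((\<lambda>z. euler_flow h x z k) has_field_derivative euler_deriv h x z k) (at z)"
proof (induction k)
  case (Suc k)
  show ?case
    using euler_flow_nonzero[OF assms, of x k]
    by (auto intro!: derivative_eq_intros Suc simp: field_simps power2_eq_square)
qed simp

text \<open>Every step is a holomorphic self-map of the upper half-plane, so this is the Schwarz-Pick inequality;
  here it follows because the factor \<open>1 + 2 * h / \<bar>Z\<bar>\<^sup>2\<close> by which \<open>Im Z\<close> grows dominates the modulus of
  the factor of the derivative.\<close>

lemma norm_euler_deriv_le:
  assumes "0 \<le> h" "0 < Im z"
  shows "cmod (euler_deriv h x z k) * Im z \<le> Im (euler_flow h x z k)"
proof (induction k)
  case (Suc k)
  let ?Z = "euler_flow h x z k" and ?D = "euler_deriv h x z k"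
  have pos: "0 < Im ?Z" using Im_euler_flow_ge[OF assms, of x k] assms by linarith
  have "cmod (1 + 2 * of_real h / ?Z\<^sup>2) \<le> 1 + 2 * h / (cmod ?Z)\<^sup>2"
    using norm_triangle_ineq[of 1 "2 * of_real h / ?Z\<^sup>2"] assms
    by (simp add: norm_divide norm_power norm_mult)
  then have "cmod ?D * Im z * cmod (1 + 2 * of_real h / ?Z\<^sup>2) \<le> Im ?Z * (1 + 2 * h / (cmod ?Z)\<^sup>2)"
    using Suc pos assms by (intro mult_mono) auto
  then show ?case
    using Im_euler_flow_Suc[OF assms(1) pos] by (simp add: norm_mult mult_ac)
qed simp

lemma euler_flow_cong:
  assumes "\<And>i. i < k \<Longrightarrow> x i = x' i"
  shows "euler_flow h x z k = euler_flow h x' z k \<and> euler_deriv h x z k = euler_deriv h x' z k"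
  using assms by (induction k) auto

lemma euler_flow_measurable:
  assumes "\<And>i. i < k \<Longrightarrow> (\<lambda>\<omega>. x \<omega> i) \<in> borel_measurable M"
  shows "(\<lambda>\<omega>. euler_flow h (x \<omega>) z k) \<in> borel_measurable M"
    and "(\<lambda>\<omega>. euler_deriv h (x \<omega>) z k) \<in> borel_measurable M"
proof -
  have "(\<lambda>\<omega>. euler_flow h (x \<omega>) z k) \<in> borel_measurable M \<and> (\<lambda>\<omega>. euler_deriv h (x \<omega>) z k) \<in> borel_measurable M"
    using assms
  proof (induction k)
    case (Suc k)
    have [measurable]: "(\<lambda>\<omega>. euler_flow h (x \<omega>) z k) \<in> borel_measurable M"
      "(\<lambda>\<omega>. euler_deriv h (x \<omega>) z k) \<in> borel_measurable M" "(\<lambda>\<omega>. x \<omega> k) \<in> borel_measurable M"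
      using Suc by auto
    show ?case by simp
  qed simp
  then show "(\<lambda>\<omega>. euler_flow h (x \<omega>) z k) \<in> borel_measurable M"
    "(\<lambda>\<omega>. euler_deriv h (x \<omega>) z k) \<in> borel_measurable M" by auto
qed

lemma measurable_flow_weight [measurable]:
  assumes [measurable]: "D \<in> borel_measurable M" "Z \<in> borel_measurable M"
  shows "(\<lambda>\<omega>. flow_weight a c b (D \<omega>) (Z \<omega>)) \<in> borel_measurable M"
  unfolding flow_weight_def by measurable

text \<open>The state after \<open>k\<close> steps depends on the first \<open>k\<close> noise variables only, so integrating out the last
  variable first reduces the claim to one step. The factors are uniform because \<open>\<bar>Z\<bar>\<close> never drops below
  the initial imaginary part.\<close>

lemma euler_flow_weight_bound:
  fixes \<kappa> b :: real
  assumes "\<kappa> \<ge> 0" "b \<ge> 0"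
  defines "a \<equiv> 2 * b + \<kappa> * b * (1 - b) / 2" and "c \<equiv> - \<kappa> * b\<^sup>2 / 2"
  obtains K where "K > 0"
    "\<And>h z k. 0 \<le> h \<Longrightarrow> 0 < Im z \<Longrightarrow> 16 * h \<le> (Im z)\<^sup>2 \<Longrightarrow>
      (\<integral>\<^sup>+ x. ennreal (flow_weight a c b
          (euler_deriv h (\<lambda>i. sqrt \<kappa> * sqrt h * x i) z k)
          (euler_flow h (\<lambda>i. sqrt \<kappa> * sqrt h * x i) z k)) \<partial>Pi\<^sub>M {..<k} (\<lambda>_. std_gaussian))
        \<le> ennreal (flow_weight a c b 1 z * (1 + K * (sqrt h / Im z) ^ 3) ^ k)"
proof -
  obtain K where K: "K > 0" and E:
    "\<And>h D Z. 0 \<le> h \<Longrightarrow> 0 < Im Z \<Longrightarrow> 16 * h \<le> (cmod Z)\<^sup>2 \<Longrightarrow>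
      (\<integral>\<^sup>+ x. ennreal (flow_weight a c b (D * (1 + 2 * of_real h / Z\<^sup>2))
          (Z - 2 * of_real h / Z + of_real (sqrt \<kappa> * sqrt h * x))) \<partial>std_gaussian)
        \<le> ennreal (flow_weight a c b D Z * (1 + K * (sqrt h / cmod Z) ^ 3))"
    using flow_weight_step[OF assms(1,2)] unfolding a_def c_def by metis
  interpret std: prob_space std_gaussian by (rule prob_space_std_gaussian)
  interpret product_sigma_finite "\<lambda>_::nat. std_gaussian" by standard
  show thesis
  proof (rule that[OF K])
    fix h :: real and z k assume h: "0 \<le> h" and z: "0 < Im z" and hz: "16 * h \<le> (Im z)\<^sup>2"
    define \<sigma> where "\<sigma> = sqrt \<kappa> * sqrt h"
    define D where "D k x = euler_deriv h (\<lambda>i. \<sigma> * x i) z k" for k x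
    define Z where "Z k x = euler_flow h (\<lambda>i. \<sigma> * x i) z k" for k x
    define F where "F = 1 + K * (sqrt h / Im z) ^ 3"
    have F: "F \<ge> 0" unfolding F_def using K h z by simp
    have meas: "D j \<in> borel_measurable (Pi\<^sub>M {..<k} (\<lambda>_. std_gaussian))"
      "Z j \<in> borel_measurable (Pi\<^sub>M {..<k} (\<lambda>_. std_gaussian))" if "j \<le> k" for j k
    proof -
      have m: "(\<lambda>x. \<sigma> * x i) \<in> borel_measurable (Pi\<^sub>M {..<k} (\<lambda>_. std_gaussian))" if "i < j" for i
      proof -
        have "(\<lambda>x. x i) \<in> measurable (Pi\<^sub>M {..<k} (\<lambda>_. std_gaussian)) std_gaussian"
          using that \<open>j \<le> k\<close> by (intro measurable_component_singleton) auto
        then have "(\<lambda>x. x i) \<in> borel_measurable (Pi\<^sub>M {..<k} (\<lambda>_. std_gaussian))" by simp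
        then show ?thesis by simp
      qed
      show "D j \<in> borel_measurable (Pi\<^sub>M {..<k} (\<lambda>_. std_gaussian))"
        "Z j \<in> borel_measurable (Pi\<^sub>M {..<k} (\<lambda>_. std_gaussian))"
        unfolding D_def Z_def by (intro euler_flow_measurable m; assumption)+
    qed
    have "(\<integral>\<^sup>+ x. ennreal (flow_weight a c b (D k x) (Z k x)) \<partial>Pi\<^sub>M {..<k} (\<lambda>_. std_gaussian))
        \<le> ennreal (flow_weight a c b 1 z * F ^ k)"
    proof (induction k)
      case 0
      interpret P0: prob_space "Pi\<^sub>M {..<0::nat} (\<lambda>_. std_gaussian)"
        by (intro prob_space_PiM prob_space_std_gaussian)
      show ?case unfolding D_def Z_def by (simp add: P0.emeasure_space_1[unfolded lessThan_0])
    next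
      case (Suc k)
      have [measurable]: "D (Suc k) \<in> borel_measurable (Pi\<^sub>M (insert k {..<k}) (\<lambda>_. std_gaussian))"
        "Z (Suc k) \<in> borel_measurable (Pi\<^sub>M (insert k {..<k}) (\<lambda>_. std_gaussian))"
        using meas[of "Suc k" "Suc k"] by (simp_all add: lessThan_Suc)
      have step: "(\<integral>\<^sup>+ y. ennreal (flow_weight a c b (D (Suc k) (x(k := y))) (Z (Suc k) (x(k := y)))) \<partial>std_gaussian)
          \<le> ennreal F * ennreal (flow_weight a c b (D k x) (Z k x))" for x
      proof -
        have same: "euler_flow h (\<lambda>i. \<sigma> * (x(k := y)) i) z k = Z k x"
          "euler_deriv h (\<lambda>i. \<sigma> * (x(k := y)) i) z k = D k x" for y
          unfolding Z_def D_def using euler_flow_cong[of k "\<lambda>i. \<sigma> * (x(k := y)) i" "\<lambda>i. \<sigma> * x i"] by auto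
        have Zk: "Im z \<le> Im (Z k x)" unfolding Z_def by (rule Im_euler_flow_ge[OF h z])
        have cZ: "Im z \<le> cmod (Z k x)" unfolding Z_def by (rule norm_euler_flow_ge[OF h z])
        have "(\<integral>\<^sup>+ y. ennreal (flow_weight a c b (D (Suc k) (x(k := y))) (Z (Suc k) (x(k := y)))) \<partial>std_gaussian)
          = (\<integral>\<^sup>+ y. ennreal (flow_weight a c b (D k x * (1 + 2 * of_real h / (Z k x)\<^sup>2))
              (Z k x - 2 * of_real h / Z k x + of_real (sqrt \<kappa> * sqrt h * y))) \<partial>std_gaussian)"
          by (simp add: D_def[of "Suc k"] Z_def[of "Suc k"] same flip: \<sigma>_def del: fun_upd_apply)
             (simp add: \<sigma>_def)
        also have "\<dots> \<le> ennreal (flow_weight a c b (D k x) (Z k x) * (1 + K * (sqrt h / cmod (Z k x)) ^ 3))"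
        proof (rule E[OF h])
          show "0 < Im (Z k x)" using Zk z by simp
          have "(Im z)\<^sup>2 \<le> (cmod (Z k x))\<^sup>2" using cZ z by (intro power_mono) auto
          then show "16 * h \<le> (cmod (Z k x))\<^sup>2" using hz by simp
        qed
        also have "\<dots> \<le> ennreal (flow_weight a c b (D k x) (Z k x) * F)"
        proof -
          have "sqrt h / cmod (Z k x) \<le> sqrt h / Im z"
            using cZ z h by (intro divide_left_mono) (auto intro!: mult_pos_pos)
          then have "(sqrt h / cmod (Z k x)) ^ 3 \<le> (sqrt h / Im z) ^ 3"
            using h by (intro power_mono) auto
          then show ?thesis unfolding F_def using K
            by (intro ennreal_leI mult_left_mono flow_weight_nonneg) auto
        qed
        also have "\<dots> = ennreal F * ennreal (flow_weight a c b (D k x) (Z k x))"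
          using F flow_weight_nonneg by (simp add: ennreal_mult[symmetric] mult.commute)
        finally show ?thesis .
      qed
      have "(\<integral>\<^sup>+ x. ennreal (flow_weight a c b (D (Suc k) x) (Z (Suc k) x)) \<partial>Pi\<^sub>M {..<Suc k} (\<lambda>_. std_gaussian))
        = (\<integral>\<^sup>+ x. (\<integral>\<^sup>+ y. ennreal (flow_weight a c b (D (Suc k) (x(k := y))) (Z (Suc k) (x(k := y)))) \<partial>std_gaussian)
            \<partial>Pi\<^sub>M {..<k} (\<lambda>_. std_gaussian))"
        unfolding lessThan_Suc by (rule product_nn_integral_insert) auto
      also have "\<dots> \<le> (\<integral>\<^sup>+ x. ennreal F * ennreal (flow_weight a c b (D k x) (Z k x)) \<partial>Pi\<^sub>M {..<k} (\<lambda>_. std_gaussian))"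
        by (intro nn_integral_mono step)
      also have "\<dots> = ennreal F * (\<integral>\<^sup>+ x. ennreal (flow_weight a c b (D k x) (Z k x)) \<partial>Pi\<^sub>M {..<k} (\<lambda>_. std_gaussian))"
        using meas[of k k] by (intro nn_integral_cmult) auto
      also have "\<dots> \<le> ennreal F * ennreal (flow_weight a c b 1 z * F ^ k)"
        by (intro mult_left_mono Suc) auto
      also have "\<dots> = ennreal (flow_weight a c b 1 z * F ^ Suc k)"
        using F flow_weight_nonneg by (simp add: ennreal_mult[symmetric] mult_ac)
      finally show ?case .
    qed
    then show "(\<integral>\<^sup>+ x. ennreal (flow_weight a c b
          (euler_deriv h (\<lambda>i. sqrt \<kappa> * sqrt h * x i) z k)
          (euler_flow h (\<lambda>i. sqrt \<kappa> * sqrt h * x i) z k)) \<partial>Pi\<^sub>M {..<k} (\<lambda>_. std_gaussian))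
        \<le> ennreal (flow_weight a c b 1 z * (1 + K * (sqrt h / Im z) ^ 3) ^ k)"
      unfolding D_def Z_def F_def \<sigma>_def .
  qed
qed

section \<open>Solutions of the Loewner equation\<close>

text \<open>Picard iteration. Successive iterates differ by at most \<open>M * L ^ k * t ^ (k + 1) / (k + 1)!\<close>, which is
  summable on the whole interval, so no subdivision into short intervals is needed.\<close>

lemma picard_lindelof:
  fixes v :: "real \<Rightarrow> 'a::banach \<Rightarrow> 'a"
  assumes T: "0 \<le> T"
    and cont: "continuous_on ({0..T} \<times> UNIV) (\<lambda>(s, x). v s x)"
    and lip: "\<And>s x y. s \<in> {0..T} \<Longrightarrow> norm (v s x - v s y) \<le> L * norm (x - y)"
  obtains u where "u 0 = x0"
    "\<And>s. s \<in> {0..T} \<Longrightarrow> (u has_vector_derivative v s (u s)) (at s within {0..T})"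
proof -
  define L' where "L' = \<bar>L\<bar> + 1"
  have L': "L' > 0" unfolding L'_def by simp
  have lip': "norm (v s x - v s y) \<le> L' * norm (x - y)" if "s \<in> {0..T}" for s x y
  proof -
    have "L * norm (x - y) \<le> L' * norm (x - y)"
      unfolding L'_def by (intro mult_right_mono) auto
    then show ?thesis using lip[OF that, of x y] by linarith
  qed
  have vcont: "continuous_on {0..T} (\<lambda>s. v s (u s))" if "continuous_on {0..T} u" for u
  proof -
    have "continuous_on {0..T} (\<lambda>s. (s, u s))" by (intro continuous_intros that)
    then have "continuous_on {0..T} (\<lambda>s. (\<lambda>(s, x). v s x) (s, u s))"
      by (rule continuous_on_compose2[OF cont]) auto
    then show ?thesis by simp
  qed
  have vint: "(\<lambda>s. v s (u s)) integrable_on {0..t}" if "continuous_on {0..T} u" "t \<in> {0..T}" for u t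
    using vcont[OF that(1)] that(2)
    by (intro integrable_continuous_real) (auto intro: continuous_on_subset)
  define U where "U = rec_nat (\<lambda>_. x0) (\<lambda>_ u t. x0 + integral {0..t} (\<lambda>s. v s (u s)))"
  have U0: "U 0 = (\<lambda>_. x0)" and US: "U (Suc k) = (\<lambda>t. x0 + integral {0..t} (\<lambda>s. v s (U k s)))" for k
    unfolding U_def by simp_all
  have Ucont: "continuous_on {0..T} (U k)" for k
  proof (induction k)
    case (Suc k)
    show ?case unfolding US
      by (intro continuous_intros indefinite_integral_continuous_1 vint Suc) (use T in auto)
  qed (simp add: U0)
  have "compact ((\<lambda>s. v s x0) ` {0..T})"
    using vcont[of "\<lambda>_. x0"] by (intro compact_continuous_image) auto
  then obtain M where M: "\<And>s. s \<in> {0..T} \<Longrightarrow> norm (v s x0) \<le> M"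
    using compact_imp_bounded bounded_iff by (metis imageI)
  have M0: "M \<ge> 0" using order_trans[OF norm_ge_zero M[of 0]] T by simp
  define m where "m k t = M * L' ^ k * t ^ Suc k / fact (Suc k)" for k and t :: real
  have diff: "norm (U (Suc k) t - U k t) \<le> m k t" if "t \<in> {0..T}" for k t
    using that
  proof (induction k arbitrary: t)
    case 0
    have "norm (integral {0..t} (\<lambda>s. v s x0)) \<le> integral {0..t} (\<lambda>s. M)"
      using vint[of "\<lambda>_. x0"] M 0 by (intro integral_norm_bound_integral) auto
    then show ?case unfolding US U0 m_def using 0 by (simp add: mult.commute)
  next
    case (Suc k)
    have "U (Suc (Suc k)) t - U (Suc k) t = integral {0..t} (\<lambda>s. v s (U (Suc k) s) - v s (U k s))"
      using integral_diff[OF vint[OF Ucont[of "Suc k"] Suc.prems] vint[OF Ucont[of k] Suc.prems]]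
        fun_cong[OF US[of "Suc k"], of t] fun_cong[OF US[of k], of t] by simp
    also have "norm \<dots> \<le> integral {0..t} (\<lambda>s. L' * m k s)"
    proof (rule integral_norm_bound_integral)
      show "(\<lambda>s. v s (U (Suc k) s) - v s (U k s)) integrable_on {0..t}"
        by (intro integrable_diff vint Ucont Suc.prems)
      show "(\<lambda>s. L' * m k s) integrable_on {0..t}"
        unfolding m_def by (intro integrable_continuous_real continuous_intros) auto
      fix s assume "s \<in> {0..t}"
      then have s: "s \<in> {0..T}" using Suc.prems by auto
      have "norm (v s (U (Suc k) s) - v s (U k s)) \<le> L' * norm (U (Suc k) s - U k s)"
        by (rule lip'[OF s])
      also have "\<dots> \<le> L' * m k s" using Suc.IH[OF s] L' by (intro mult_left_mono) auto
      finally show "norm (v s (U (Suc k) s) - v s (U k s)) \<le> L' * m k s" .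
    qed
    also have "integral {0..t} (\<lambda>s. L' * m k s) = m (Suc k) t - m (Suc k) 0"
    proof (rule integral_unique, rule fundamental_theorem_of_calculus)
      show "0 \<le> t" using Suc.prems by simp
      fix s assume "s \<in> {0..t}"
      have "(m (Suc k) has_field_derivative L' * m k s) (at s within {0..t})"
        unfolding m_def
        by (auto intro!: derivative_eq_intros simp del: power_Suc) (simp add: field_simps)
      then show "(m (Suc k) has_vector_derivative L' * m k s) (at s within {0..t})"
        by (simp add: has_real_derivative_iff_has_vector_derivative)
    qed
    finally show ?case by (simp add: m_def)
  qed
  have msum: "summable (\<lambda>k. m k T)"
  proof -
    have "summable (\<lambda>k. (L' * T) ^ Suc k / fact (Suc k))"
      using summable_exp_generic[of "L' * T"]
      by (subst summable_Suc_iff) (simp add: divide_inverse mult.commute)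
    then have "summable (\<lambda>k. (M / L') * ((L' * T) ^ Suc k / fact (Suc k)))" by (rule summable_mult)
    moreover have "(M / L') * ((L' * T) ^ Suc k / fact (Suc k)) = m k T" for k
      unfolding m_def using L' by (simp add: field_simps power_mult_distrib)
    ultimately show ?thesis by (simp only:)
  qed
  define u where "u t = x0 + (\<Sum>k. U (Suc k) t - U k t)" for t
  have ulim: "uniform_limit {0..T} U u sequentially"
  proof -
    have "uniform_limit {0..T} (\<lambda>n t. \<Sum>k<n. U (Suc k) t - U k t) (\<lambda>t. \<Sum>k. U (Suc k) t - U k t) sequentially"
    proof (rule Weierstrass_m_test[OF _ msum])
      fix k t assume t: "t \<in> {0..T}"
      have "m k t \<le> m k T"
        unfolding m_def using t M0 L' by (intro divide_right_mono mult_left_mono power_mono) auto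
      with diff[OF t, of k] show "norm (U (Suc k) t - U k t) \<le> m k T" by linarith
    qed
    then have "uniform_limit {0..T} (\<lambda>n t. x0 + (\<Sum>k<n. U (Suc k) t - U k t)) u sequentially"
      unfolding u_def by (intro uniform_limit_intros)
    moreover have "(\<lambda>n t. x0 + (\<Sum>k<n. U (Suc k) t - U k t)) = U"
    proof (intro ext)
      show "x0 + (\<Sum>k<n. U (Suc k) t - U k t) = U n t" for n t
        using sum_lessThan_telescope[of "\<lambda>k. U k t" n] by (simp add: U0)
    qed
    ultimately show ?thesis by simp
  qed
  have ucont: "continuous_on {0..T} u"
    by (rule uniform_limit_theorem[OF _ ulim]) (use Ucont in auto)
  have vlim: "uniform_limit {0..T} (\<lambda>n s. v s (U n s)) (\<lambda>s. v s (u s)) sequentially"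
  proof (rule uniform_limitI)
    fix e :: real assume "e > 0"
    then have "e / L' > 0" using L' by simp
    from uniform_limitD[OF ulim this]
    show "\<forall>\<^sub>F n in sequentially. \<forall>s\<in>{0..T}. dist (v s (U n s)) (v s (u s)) < e"
    proof eventually_elim
      case (elim n)
      show ?case
      proof
        fix s assume s: "s \<in> {0..T}"
        have "dist (v s (U n s)) (v s (u s)) \<le> L' * dist (U n s) (u s)"
          unfolding dist_norm by (rule lip'[OF s])
        also have "\<dots> < e" using elim s L' by (auto simp: field_simps)
        finally show "dist (v s (U n s)) (v s (u s)) < e" .
      qed
    qed
  qed
  have fix_u: "u t = x0 + integral {0..t} (\<lambda>s. v s (u s))" if t: "t \<in> {0..T}" for t
  proof (rule LIMSEQ_unique)
    show "(\<lambda>n. U (Suc n) t) \<longlonglongrightarrow> u t"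
      using tendsto_uniform_limitI[OF ulim t] by (rule LIMSEQ_Suc)
    have "uniform_limit {0..t} (\<lambda>n s. v s (U n s)) (\<lambda>s. v s (u s)) sequentially"
      using vlim by (rule uniform_limit_on_subset) (use t in auto)
    then obtain I J where I: "\<And>n. ((\<lambda>s. v s (U n s)) has_integral I n) {0..t}"
      and J: "((\<lambda>s. v s (u s)) has_integral J) {0..t}" and IJ: "I \<longlonglongrightarrow> J"
    proof (rule uniform_limit_integral)
      show "continuous_on {0..t} (\<lambda>s. v s (U n s))" for n
        using vcont[OF Ucont] by (rule continuous_on_subset) (use t in auto)
    qed auto
    have "(\<lambda>n. x0 + I n) \<longlonglongrightarrow> x0 + J" by (intro tendsto_intros IJ)
    moreover have "I n = integral {0..t} (\<lambda>s. v s (U n s))" for n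
      using integral_unique[OF I] by simp
    moreover have "J = integral {0..t} (\<lambda>s. v s (u s))" using integral_unique[OF J] by simp
    ultimately show "(\<lambda>n. U (Suc n) t) \<longlonglongrightarrow> x0 + integral {0..t} (\<lambda>s. v s (u s))"
      unfolding US by simp
  qed
  show thesis
  proof (rule that[of u])
    show "u 0 = x0" using fix_u[of 0] T by simp
    fix s assume s: "s \<in> {0..T}"
    have "((\<lambda>t. x0 + integral {0..t} (\<lambda>s. v s (u s))) has_vector_derivative v s (u s)) (at s within {0..T})"
      using integral_has_vector_derivative[OF vcont[OF ucont] s] by (auto intro!: derivative_eq_intros)
    then show "(u has_vector_derivative v s (u s)) (at s within {0..T})"
      by (rule has_vector_derivative_transform[OF s, rotated]) (rule fix_u)
  qed
qed

text \<open>The product with the integrating factor is constant. The difference of two Loewner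
  solutions satisfies such an equation, which yields uniqueness and injectivity at once.\<close>

lemma linear_ode_solution:
  fixes d q :: "real \<Rightarrow> complex"
  assumes T: "0 \<le> T" and q: "continuous_on {0..T} q"
    and d: "\<And>s. s \<in> {0..T} \<Longrightarrow> (d has_vector_derivative q s * d s) (at s within {0..T})"
  shows "d T = d 0 * exp (integral {0..T} q)"
proof -
  define Q where "Q s = integral {0..s} q" for s
  define e where "e s = d s * exp (- Q s)" for s
  have "(e has_vector_derivative 0) (at s within {0..T})" if s: "s \<in> {0..T}" for s
  proof -
    have "(Q has_vector_derivative q s) (at s within {0..T})"
      unfolding Q_def by (rule integral_has_vector_derivative[OF q s])
    then have "((\<lambda>s. - Q s) has_vector_derivative - q s) (at s within {0..T})"
      by (rule has_vector_derivative_minus)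
    then have "((exp \<circ> (\<lambda>s. - Q s)) has_vector_derivative - q s * exp (- Q s)) (at s within {0..T})"
      by (rule field_vector_diff_chain_within) (auto intro!: derivative_eq_intros)
    then have "((\<lambda>s. d s * exp (- Q s)) has_vector_derivative
        d s * (- q s * exp (- Q s)) + q s * d s * exp (- Q s)) (at s within {0..T})"
      by (intro has_vector_derivative_mult d s) (simp add: o_def)
    then show ?thesis unfolding e_def by (simp add: algebra_simps)
  qed
  then obtain k where k: "\<And>s. s \<in> {0..T} \<Longrightarrow> e s = k"
    using has_vector_derivative_zero_constant[of "{0..T}" e] by auto
  have "e T = e 0" using k[of T] k[of 0] T by simp
  then show ?thesis
    unfolding e_def Q_def by (simp add: exp_minus field_simps)
qed

text \<open>Projection onto the half-plane \<open>Im x \<ge> y\<close>. Composing the Loewner vector field with it produces a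
  globally Lipschitz field that agrees with the original one as long as the solution stays in that
  half-plane.\<close>

definition clamp_Im :: "real \<Rightarrow> complex \<Rightarrow> complex"
  where "clamp_Im y x = Complex (Re x) (max (Im x) y)"

lemma clamp_Im_simps [simp]: "Re (clamp_Im y x) = Re x" "Im (clamp_Im y x) = max (Im x) y"
  by (simp_all add: clamp_Im_def)

lemma clamp_Im_id: "y \<le> Im x \<Longrightarrow> clamp_Im y x = x"
  by (simp add: complex_eq_iff)

lemma norm_clamp_Im_diff: "cmod (clamp_Im y x - clamp_Im y x') \<le> cmod (x - x')"
proof -
  have "\<bar>max (Im x) y - max (Im x') y\<bar> \<le> \<bar>Im x - Im x'\<bar>" by auto
  then have "(max (Im x) y - max (Im x') y)\<^sup>2 \<le> (Im x - Im x')\<^sup>2" by (rule power2_mono)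
  then show ?thesis by (simp add: cmod_def)
qed

lemma norm_inverse_diff_le:
  fixes p q :: complex
  assumes "y > 0" "y \<le> Im p" "y \<le> Im q"
  shows "cmod (c / p - c / q) \<le> cmod c / y\<^sup>2 * cmod (p - q)"
proof -
  have pq: "y \<le> cmod p" "y \<le> cmod q"
    using assms abs_Im_le_cmod[of p] abs_Im_le_cmod[of q] by linarith+
  then have nz: "p \<noteq> 0" "q \<noteq> 0" using assms by auto
  have "c / p - c / q = c * (q - p) / (p * q)" using nz by (simp add: field_simps)
  then have "cmod (c / p - c / q) = cmod c * cmod (p - q) / (cmod p * cmod q)"
    by (simp add: norm_divide norm_mult norm_minus_commute)
  also have "\<dots> \<le> cmod c * cmod (p - q) / (y * y)"
    using pq assms nz by (intro divide_left_mono mult_mono) auto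
  finally show ?thesis by (simp add: power2_eq_square)
qed

lemma clamped_loewner_solution:
  fixes \<xi> :: "real \<Rightarrow> real" and c z :: complex
  assumes T: "0 \<le> T" and y: "0 < y" and \<xi>: "continuous_on {0..T} \<xi>"
  obtains u where "u 0 = z"
    "\<And>s. s \<in> {0..T} \<Longrightarrow>
      (u has_vector_derivative c / (clamp_Im y (u s) - of_real (\<xi> s))) (at s within {0..T})"
proof (rule picard_lindelof[OF T, of "\<lambda>s x. c / (clamp_Im y x - of_real (\<xi> s))" "cmod c / y\<^sup>2" z])
  have "continuous_on UNIV (clamp_Im y)"
    unfolding clamp_Im_def Complex_eq by (intro continuous_intros)
  then have "continuous_on ({0..T} \<times> UNIV) (\<lambda>p. clamp_Im y (snd p))"
    by (rule continuous_on_compose2) (auto intro!: continuous_intros)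
  moreover have "continuous_on ({0..T} \<times> UNIV) (\<lambda>p. \<xi> (fst p) :: real)"
    by (rule continuous_on_compose2[OF \<xi>]) (auto intro!: continuous_intros)
  moreover have "clamp_Im y x - of_real t \<noteq> 0" for x t
    using y by (auto simp: complex_eq_iff)
  ultimately show "continuous_on ({0..T} \<times> UNIV) (\<lambda>(s, x). c / (clamp_Im y x - of_real (\<xi> s)))"
    unfolding case_prod_beta by (intro continuous_intros) auto
next
  fix s :: real and x x' :: complex
  have "cmod (c / (clamp_Im y x - of_real (\<xi> s)) - c / (clamp_Im y x' - of_real (\<xi> s)))
      \<le> cmod c / y\<^sup>2 * cmod ((clamp_Im y x - of_real (\<xi> s)) - (clamp_Im y x' - of_real (\<xi> s)))"
    using y by (intro norm_inverse_diff_le) auto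
  also have "\<dots> \<le> cmod c / y\<^sup>2 * cmod (x - x')"
    using norm_clamp_Im_diff by (intro mult_left_mono) auto
  finally show "cmod (c / (clamp_Im y x - of_real (\<xi> s)) - c / (clamp_Im y x' - of_real (\<xi> s)))
      \<le> cmod c / y\<^sup>2 * cmod (x - x')" .
qed (use that in auto)

lemma nonneg_derivative_imp_ge_start:
  fixes g :: "real \<Rightarrow> real"
  assumes "\<And>s. s \<in> {0..T} \<Longrightarrow> (g has_vector_derivative g' s) (at s within {0..T})"
    and "\<And>s. s \<in> {0..T} \<Longrightarrow> 0 \<le> g' s" and t: "t \<in> {0..T}"
  shows "g 0 \<le> g t"
proof -
  have "(g has_derivative (\<lambda>h. h * g' s)) (at s within {0..t})" if "s \<in> {0..t}" for s
    using assms(1)[of s] that t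
    by (auto simp: has_vector_derivative_def intro: has_derivative_subset)
  then obtain x where "x \<in> {0..t}" "g t - g 0 = (t - 0) * g' x"
    using mvt_very_simple[of 0 t g "\<lambda>s h. h * g' s"] t by auto
  moreover from this have "0 \<le> t * g' x" using assms(2)[of x] t by (intro mult_nonneg_nonneg) auto
  ultimately show ?thesis by simp
qed

text \<open>In the reverse direction even the clamped field points upwards, so the solution never leaves the
  half-plane \<open>Im \<ge> Im z\<close> and solves the original equation for all times.\<close>

lemma reverse_loewner_solution:
  fixes \<xi> :: "real \<Rightarrow> real"
  assumes T: "0 \<le> T" and z: "0 < Im z" and \<xi>: "continuous_on {0..T} \<xi>"
  obtains w where "w 0 = z" "\<And>s. s \<in> {0..T} \<Longrightarrow> Im z \<le> Im (w s)"
    "\<And>s. s \<in> {0..T} \<Longrightarrow> (w has_vector_derivative - 2 / (w s - of_real (\<xi> s))) (at s within {0..T})"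
proof -
  obtain w where w0: "w 0 = z" and
    w: "\<And>s. s \<in> {0..T} \<Longrightarrow>
      (w has_vector_derivative - 2 / (clamp_Im (Im z) (w s) - of_real (\<xi> s))) (at s within {0..T})"
    using clamped_loewner_solution[OF T z \<xi>] by metis
  have im: "Im z \<le> Im (w s)" if s: "s \<in> {0..T}" for s
  proof -
    have "((\<lambda>s. Im (w s)) has_vector_derivative
        Im (- 2 / (clamp_Im (Im z) (w s) - of_real (\<xi> s)))) (at s within {0..T})"
      if "s \<in> {0..T}" for s
      by (rule bounded_linear.has_vector_derivative[OF bounded_linear_Im w[OF that]])
    then have "Im (w 0) \<le> Im (w s)"
      by (rule nonneg_derivative_imp_ge_start[OF _ _ s]) (use z in \<open>auto simp: Im_divide\<close>)
    then show ?thesis using w0 by simp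
  qed
  show thesis
    using that[of w, OF w0 im] w clamp_Im_id[OF im] by simp
qed

text \<open>In the forward direction the imaginary part decreases, but by continuity it stays above half of its
  initial value for a short time.\<close>

lemma forward_loewner_solution:
  fixes \<xi> :: "real \<Rightarrow> real"
  assumes z: "0 < Im z" and \<xi>: "continuous_on {0..1} \<xi>"
  obtains \<eta> f where "0 < \<eta>" "f 0 = z" "\<And>s. s \<in> {0..\<eta>} \<Longrightarrow> 0 < Im (f s)"
    "\<And>s. s \<in> {0..\<eta>} \<Longrightarrow> (f has_vector_derivative 2 / (f s - of_real (\<xi> s))) (at s within {0..\<eta>})"
proof -
  define y where "y = Im z / 2"
  have y: "0 < y" unfolding y_def using z by simp
  obtain f where f0: "f 0 = z" and
    f: "\<And>s. s \<in> {0..1} \<Longrightarrow>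
      (f has_vector_derivative 2 / (clamp_Im y (f s) - of_real (\<xi> s))) (at s within {0..1})"
    using clamped_loewner_solution[OF _ y \<xi>, of z 2] by auto
  have "continuous_on {0..1} f"
    using f by (rule continuous_on_vector_derivative)
  then have "continuous (at 0 within {0..1}) f" by (simp add: continuous_on_eq_continuous_within)
  then have "((\<lambda>s. Im (f s)) \<longlongrightarrow> Im (f 0)) (at 0 within {0..1})"
    by (intro tendsto_intros) (simp add: continuous_within)
  moreover have "y < Im (f 0)" unfolding f0 y_def using z by simp
  ultimately have "\<forall>\<^sub>F s in at 0 within {0..1}. y < Im (f s)" by (rule order_tendstoD)
  then obtain d where d: "d > 0" "\<And>s. s \<in> {0..1} \<Longrightarrow> s \<noteq> 0 \<Longrightarrow> dist s 0 < d \<Longrightarrow> y < Im (f s)"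
    unfolding eventually_at by blast
  define \<eta> where "\<eta> = min 1 (d / 2)"
  have \<eta>: "0 < \<eta>" "\<eta> \<le> 1" unfolding \<eta>_def using d by auto
  have im: "y < Im (f s)" if "s \<in> {0..\<eta>}" for s
  proof (cases "s = 0")
    case True
    then show ?thesis unfolding y_def using f0 z by simp
  next
    case False
    then show ?thesis using that d unfolding \<eta>_def by (intro d(2)) auto
  qed
  show thesis
  proof (rule that[of \<eta> f, OF \<eta>(1) f0])
    fix s assume s: "s \<in> {0..\<eta>}"
    show "0 < Im (f s)" using im[OF s] y by simp
    have "(f has_vector_derivative 2 / (clamp_Im y (f s) - of_real (\<xi> s))) (at s within {0..\<eta>})"
      using f[of s] s \<eta> by (auto intro: has_vector_derivative_within_subset)
    then show "(f has_vector_derivative 2 / (f s - of_real (\<xi> s))) (at s within {0..\<eta>})"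
      using clamp_Im_id[of y "f s"] im[OF s] by simp
  qed
qed

section \<open>The inverse map as a reverse flow\<close>

text \<open>The difference of two solutions solves the linear equation with the coefficient
  \<open>- 2 / ((u - \<xi>) * (u' - \<xi>))\<close>, hence it vanishes at time \<open>t\<close> if and only if it vanishes at time \<open>0\<close>.\<close>

lemma solves_loewner_eq_iff:
  assumes \<xi>: "continuous_on {0..} \<xi>" and t: "0 \<le> t"
    and u: "solves_loewner \<xi> z T u" "ereal t < T"
    and u': "solves_loewner \<xi> z' T' u'" "ereal t < T'"
  shows "u t = u' t \<longleftrightarrow> z = z'"
proof -
  have low: "ereal s < T" "ereal s < T'" if "s \<in> {0..t}" for s
    using that u(2) u'(2) by (auto intro: le_less_trans[of "ereal s" "ereal t"])
  have nz: "u s \<noteq> of_real (\<xi> s)" "u' s \<noteq> of_real (\<xi> s)" if "s \<in> {0..t}" for s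
    using u(1) u'(1) low[OF that] that unfolding solves_loewner_def by auto
  have der: "(u has_vector_derivative 2 / (u s - of_real (\<xi> s))) (at s within {0..t})"
    "(u' has_vector_derivative 2 / (u' s - of_real (\<xi> s))) (at s within {0..t})" if "s \<in> {0..t}" for s
    using u(1) u'(1) low[OF that] that unfolding solves_loewner_def
    by (auto intro: has_vector_derivative_within_subset[where S = "{0..}"])
  have cont: "continuous_on {0..t} u" "continuous_on {0..t} u'"
    by (rule continuous_on_vector_derivative, erule der)+
  have \<xi>t: "continuous_on {0..t} \<xi>" using \<xi> by (rule continuous_on_subset) auto
  define q where "q s = - 2 / ((u s - of_real (\<xi> s)) * (u' s - of_real (\<xi> s)))" for s
  have "continuous_on {0..t} q"
    unfolding q_def using nz by (intro continuous_intros cont \<xi>t) auto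
  moreover have "((\<lambda>s. u s - u' s) has_vector_derivative q s * (u s - u' s)) (at s within {0..t})"
    if s: "s \<in> {0..t}" for s
  proof -
    have "q s * (u s - u' s) = 2 / (u s - of_real (\<xi> s)) - 2 / (u' s - of_real (\<xi> s))"
      unfolding q_def using nz[OF s] by (simp add: divide_simps)
    then show ?thesis using der[OF s] by (simp add: has_vector_derivative_diff)
  qed
  ultimately have "u t - u' t = (u 0 - u' 0) * exp (integral {0..t} q)"
    by (rule linear_ode_solution[OF t])
  moreover have "u 0 = z" "u' 0 = z'" using u(1) u'(1) unfolding solves_loewner_def by auto
  ultimately show ?thesis by auto
qed

lemma loewner_flow_eq:
  assumes "continuous_on {0..} \<xi>" "0 \<le> t" "solves_loewner \<xi> z T u" "ereal t < T"
  shows "loewner_flow \<xi> t z = u t"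
  unfolding loewner_flow_def
proof (rule the_equality)
  show "\<exists>T u'. ereal t < T \<and> solves_loewner \<xi> z T u' \<and> u t = u' t" using assms by blast
  show "w = u t" if "\<exists>T u. ereal t < T \<and> solves_loewner \<xi> z T u \<and> w = u t" for w
    using that solves_loewner_eq_iff[OF assms(1,2) _ _ assms(3,4)] by blast
qed

lemma loewner_domain_solution:
  assumes "z \<in> loewner_domain \<xi> t"
  obtains T u where "solves_loewner \<xi> z T u" "ereal t < T"
  using assms unfolding loewner_domain_def loewner_lifetime_def less_Sup_iff by blast

lemma loewner_domainI:
  assumes "0 < Im z" "solves_loewner \<xi> z T u" "ereal t < T"
  shows "z \<in> loewner_domain \<xi> t"
  using assms unfolding loewner_domain_def loewner_lifetime_def less_Sup_iff upper_half_plane_def by blast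

lemma loewner_flow_inj_on:
  assumes "continuous_on {0..} \<xi>" "0 \<le> t"
  shows "inj_on (loewner_flow \<xi> t) (loewner_domain \<xi> t)"
proof (rule inj_onI)
  fix z z' assume z: "z \<in> loewner_domain \<xi> t" "z' \<in> loewner_domain \<xi> t"
    and eq: "loewner_flow \<xi> t z = loewner_flow \<xi> t z'"
  obtain T u where u: "solves_loewner \<xi> z T u" "ereal t < T" using loewner_domain_solution[OF z(1)] .
  obtain T' u' where u': "solves_loewner \<xi> z' T' u'" "ereal t < T'" using loewner_domain_solution[OF z(2)] .
  show "z = z'"
    using eq solves_loewner_eq_iff[OF assms u u'] loewner_flow_eq[OF assms u] loewner_flow_eq[OF assms u'] by simp
qed

text \<open>Reversing time turns \<open>w\<close> into a forward solution from \<open>w t\<close> to \<open>z + \<xi> t\<close> on \<open>[0, t]\<close>. To see that its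
  lifetime is strictly larger than \<open>t\<close>, it is glued to a short forward solution that starts at
  \<open>z + \<xi> t\<close> at time \<open>t\<close>.\<close>

lemma loewner_fhat_reverse:
  fixes \<xi> :: "real \<Rightarrow> real"
  assumes \<xi>: "continuous_on {0..} \<xi>" and t: "0 \<le> t" and z: "0 < Im z"
    and w0: "w 0 = z + of_real (\<xi> t)"
    and wIm: "\<And>s. s \<in> {0..t} \<Longrightarrow> Im z \<le> Im (w s)"
    and w: "\<And>s. s \<in> {0..t} \<Longrightarrow>
      (w has_vector_derivative - 2 / (w s - of_real (\<xi> (t - s)))) (at s within {0..t})"
  shows "loewner_fhat \<xi> t z = w t"
proof -
  have \<xi>t: "continuous_on {0..1} (\<lambda>r. \<xi> (t + r))"
    by (rule continuous_on_compose2[OF \<xi>]) (use t in \<open>auto intro!: continuous_intros\<close>)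
  obtain \<eta> f where \<eta>: "0 < \<eta>" and f0: "f 0 = z + of_real (\<xi> t)"
    and fIm: "\<And>s. s \<in> {0..\<eta>} \<Longrightarrow> 0 < Im (f s)"
    and f: "\<And>s. s \<in> {0..\<eta>} \<Longrightarrow>
      (f has_vector_derivative 2 / (f s - of_real (\<xi> (t + s)))) (at s within {0..\<eta>})"
    using forward_loewner_solution[of "z + of_real (\<xi> t)", OF _ \<xi>t] z by auto
  define u where "u s = (if s \<in> {0..t} then w (t - s) else f (s - t))" for s
  have left: "((\<lambda>s. w (t - s)) has_vector_derivative 2 / (w (t - s) - of_real (\<xi> s))) (at s within {0..t})"
    if s: "s \<in> {0..t}" for s
  proof -
    have "((\<lambda>s. t - s) has_vector_derivative -1) (at s within {0..t})"
      by (auto intro!: derivative_eq_intros)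
    moreover have "(w has_vector_derivative - 2 / (w (t - s) - of_real (\<xi> s))) (at (t - s) within (\<lambda>s. t - s) ` {0..t})"
      using w[of "t - s"] s by (simp add: image_diff_atLeastAtMost)
    ultimately have "((w \<circ> (\<lambda>s. t - s)) has_vector_derivative -1 *\<^sub>R (- 2 / (w (t - s) - of_real (\<xi> s)))) (at s within {0..t})"
      by (rule vector_diff_chain_within)
    then show ?thesis by (simp add: o_def)
  qed
  have right: "((\<lambda>s. f (s - t)) has_vector_derivative 2 / (f (s - t) - of_real (\<xi> s))) (at s within {t..t + \<eta>})"
    if s: "s \<in> {t..t + \<eta>}" for s
  proof -
    have "((\<lambda>s. s - t) has_vector_derivative 1) (at s within {t..t + \<eta>})"
      by (auto intro!: derivative_eq_intros)
    moreover have "(f has_vector_derivative 2 / (f (s - t) - of_real (\<xi> s))) (at (s - t) within (\<lambda>s. s - t) ` {t..t + \<eta>})"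
      using f[of "s - t"] s by (simp add: image_diff_atLeastAtMost)
    ultimately have "((f \<circ> (\<lambda>s. s - t)) has_vector_derivative 1 *\<^sub>R (2 / (f (s - t) - of_real (\<xi> s)))) (at s within {t..t + \<eta>})"
      by (rule vector_diff_chain_within)
    then show ?thesis by (simp add: o_def)
  qed
  have glue: "((\<lambda>s. if s \<in> {0..t} then w (t - s) else f (s - t)) has_vector_derivative
      (if s \<in> {0..t} then 2 / (w (t - s) - of_real (\<xi> s)) else 2 / (f (s - t) - of_real (\<xi> s))))
      (at s within {0..t + \<eta>})" if s: "s \<in> {0..t + \<eta>}" for s
  proof (rule has_vector_derivative_If_within_closures[where T = "{t..t + \<eta>}"])
    have int: "closure {0..t} \<inter> closure {t..t + \<eta>} = {t}" using t \<eta> by auto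
    show "s \<in> {0..t} \<union> {t..t + \<eta>}" "{0..t + \<eta>} = {0..t} \<union> {t..t + \<eta>}" using s t \<eta> by auto
    show "((\<lambda>s. w (t - s)) has_vector_derivative 2 / (w (t - s) - of_real (\<xi> s)))
        (at s within {0..t} \<union> (closure {0..t} \<inter> closure {t..t + \<eta>}))"
      if "s \<in> {0..t} \<union> (closure {0..t} \<inter> closure {t..t + \<eta>})"
      using left[of s] that t unfolding int by (auto simp: insert_absorb)
    show "((\<lambda>s. f (s - t)) has_vector_derivative 2 / (f (s - t) - of_real (\<xi> s)))
        (at s within {t..t + \<eta>} \<union> (closure {0..t} \<inter> closure {t..t + \<eta>}))"
      if "s \<in> {t..t + \<eta>} \<union> (closure {0..t} \<inter> closure {t..t + \<eta>})"
      using right[of s] that \<eta> unfolding int by (auto simp: insert_absorb)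
    assume "s \<in> closure {0..t}" "s \<in> closure {t..t + \<eta>}"
    then have "s = t" by simp
    then show "w (t - s) = f (s - t)"
      "2 / (w (t - s) - of_real (\<xi> s)) = 2 / (f (s - t) - of_real (\<xi> s))"
      using w0 f0 by simp_all
  qed
  have sol: "solves_loewner \<xi> (w t) (ereal (t + \<eta>)) u"
    unfolding solves_loewner_def
  proof (intro conjI allI impI)
    show "0 < ereal (t + \<eta>)" using t \<eta> by simp
    show "u 0 = w t" unfolding u_def using t by simp
    fix s :: real assume s: "0 \<le> s" "ereal s < ereal (t + \<eta>)"
    have "0 < Im (u s)" unfolding u_def using wIm[of "t - s"] fIm[of "s - t"] z s by auto
    then show "u s \<noteq> of_real (\<xi> s)" by auto
    have "(u has_vector_derivative 2 / (u s - of_real (\<xi> s))) (at s within {0..t + \<eta>})"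
      using glue[of s] s unfolding u_def by (auto split: if_splits)
    moreover have "at s within {0..t + \<eta>} = at s within {0..}"
      by (rule at_within_nhd[of _ "{..<t + \<eta>}"]) (use s in auto)
    ultimately show "(u has_vector_derivative 2 / (u s - of_real (\<xi> s))) (at s within {0..})" by simp
  qed
  have lt: "ereal t < ereal (t + \<eta>)" using \<eta> by simp
  have "0 < Im (w t)" using wIm[of t] t z by simp
  then have "w t \<in> loewner_domain \<xi> t" using sol lt by (rule loewner_domainI)
  moreover have "loewner_flow \<xi> t (w t) = z + of_real (\<xi> t)"
    unfolding loewner_flow_eq[OF \<xi> t sol lt] u_def using t w0 by simp
  ultimately show ?thesis
    unfolding loewner_fhat_def by (rule inv_into_f_eq[OF loewner_flow_inj_on[OF \<xi> t]])
qed

section \<open>Convergence of the discretisation\<close>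

text \<open>The reverse flow consumes the driving path from time \<open>t\<close> down to \<open>0\<close>, hence the reversed order.\<close>

definition reverse_increment :: "(real \<Rightarrow> real) \<Rightarrow> real \<Rightarrow> nat \<Rightarrow> nat \<Rightarrow> real"
  where "reverse_increment \<xi> t n k = \<xi> (t - real k * (t / real n)) - \<xi> (t - real (Suc k) * (t / real n))"

lemma vector_derivative_lipschitz:
  fixes f :: "real \<Rightarrow> 'a::real_normed_vector"
  assumes "\<And>x. x \<in> {a..b} \<Longrightarrow> (f has_vector_derivative f' x) (at x within {a..b})"
    and "\<And>x. x \<in> {a..b} \<Longrightarrow> norm (f' x) \<le> B" and "x \<in> {a..b}" "y \<in> {a..b}"
  shows "norm (f x - f y) \<le> B * \<bar>x - y\<bar>"
proof -
  have "norm (f x - f y) \<le> B * norm (x - y)"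
  proof (rule differentiable_bound[where f' = "\<lambda>x h. h *\<^sub>R f' x"])
    show "(f has_derivative (\<lambda>h. h *\<^sub>R f' x)) (at x within {a..b})" if "x \<in> {a..b}" for x
      using assms(1)[OF that] by (simp add: has_vector_derivative_def)
    show "onorm (\<lambda>h. h *\<^sub>R f' x) \<le> B" if "x \<in> {a..b}" for x
      using mult_right_mono[OF assms(2)[OF that] abs_ge_zero] by (intro onorm_le) (simp add: mult.commute)
  qed (use assms in auto)
  then show ?thesis by simp
qed

text \<open>The usual discrete Gronwall estimate. On \<open>Im \<ge> y\<close> the vector field is bounded by \<open>2 / y\<close> and Lipschitz
  with constant \<open>2 / y\<^sup>2\<close>, both in the position and in the driving point, so the local error is controlled
  by the step size and the modulus of continuity \<open>\<rho>\<close> of the driving function. The bound is uniform in \<open>z\<close>.\<close>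

lemma euler_flow_error:
  fixes \<xi> :: "real \<Rightarrow> real"
  assumes t: "0 \<le> t" and n: "n > 0" and y: "0 < y" "y \<le> Im z"
    and w0: "w 0 = z + of_real (\<xi> t)"
    and wIm: "\<And>s. s \<in> {0..t} \<Longrightarrow> Im z \<le> Im (w s)"
    and w: "\<And>s. s \<in> {0..t} \<Longrightarrow>
      (w has_vector_derivative - 2 / (w s - of_real (\<xi> (t - s)))) (at s within {0..t})"
    and \<rho>: "0 \<le> \<rho>" "\<And>r r'. r \<in> {0..t} \<Longrightarrow> r' \<in> {0..t} \<Longrightarrow> \<bar>r - r'\<bar> \<le> t / n \<Longrightarrow> \<bar>\<xi> r - \<xi> r'\<bar> \<le> \<rho>"
  shows "cmod (euler_flow (t / n) (reverse_increment \<xi> t n) z n + of_real (\<xi> 0) - w t)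
    \<le> t * (2 / y\<^sup>2 * (2 / y * (t / n) + \<rho>)) * exp (2 / y\<^sup>2 * t)"
proof -
  define h where "h = t / n"
  define L where "L = 2 / y\<^sup>2"
  define c where "c = L * (2 / y * h + \<rho>)"
  define W where "W k = euler_flow h (reverse_increment \<xi> t n) z k + of_real (\<xi> (t - k * h))" for k
  define v where "v s = - 2 / (w s - of_real (\<xi> (t - s)))" for s
  have h: "0 \<le> h" "n * h = t" unfolding h_def using t n by auto
  have L: "0 \<le> L" unfolding L_def by simp
  have c: "0 \<le> c" unfolding c_def using L h y \<rho> by simp
  have z: "0 < Im z" using y by linarith
  have grid: "real k * h \<in> {0..t}" if "k \<le> n" for k
  proof -
    have "real k * h \<le> real n * h" using that h by (intro mult_right_mono) auto
    then show ?thesis using h by simp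
  qed
  have WIm: "y \<le> Im (W k)" for k
    using Im_euler_flow_ge[OF h(1) z, of "reverse_increment \<xi> t n" k] y unfolding W_def by simp
  have vb: "cmod (v s) \<le> 2 / y" if "s \<in> {0..t}" for s
  proof -
    have "y \<le> Im (w s - of_real (\<xi> (t - s)))" using wIm[OF that] y by simp
    then have "y \<le> cmod (w s - of_real (\<xi> (t - s)))" using abs_Im_le_cmod[of "w s - of_real (\<xi> (t - s))"] by linarith
    then show ?thesis unfolding v_def norm_divide using y by (simp add: frac_le)
  qed
  have err: "cmod (W k - w (k * h)) \<le> k * h * c * (1 + L * h) ^ k" if "k \<le> n" for k
    using that
  proof (induction k)
    case 0
    show ?case using w0 by (simp add: W_def)
  next
    case (Suc k)
    define s0 where "s0 = real k * h"
    define s1 where "s1 = real (Suc k) * h"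
    have s: "s0 \<in> {0..t}" "s1 \<in> {0..t}" and s01: "s1 - s0 = h" "s0 \<le> s1"
      using grid[of k] grid[of "Suc k"] Suc.prems h unfolding s0_def s1_def by (auto simp: algebra_simps)
    have sub: "{s0..s1} \<subseteq> {0..t}" using s by auto
    have wd: "(w has_vector_derivative v s) (at s within {s0..s1})" if "s \<in> {s0..s1}" for s
      unfolding v_def using w[of s] that sub by (auto intro: has_vector_derivative_within_subset)
    have "cmod (w s1 - w s0 - (s1 - s0) *\<^sub>R v s0) \<le> norm (s1 - s0) * c"
    proof (rule vector_differentiable_bound_linearization[OF wd])
      show "closed_segment s0 s1 \<subseteq> {s0..s1}" using s01 by (simp add: closed_segment_eq_real_ivl)
      show "s0 \<in> {s0..s1}" using s01 by simp
      fix s assume ss: "s \<in> {s0..s1}"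
      then have st: "s \<in> {0..t}" using sub by auto
      have "cmod (w s - w s0) \<le> 2 / y * \<bar>s - s0\<bar>"
        by (rule vector_derivative_lipschitz[OF wd vb]) (use ss s01 sub in auto)
      also have "\<dots> \<le> 2 / y * h" using ss s01 y by (intro mult_left_mono) auto
      finally have 1: "cmod (w s - w s0) \<le> 2 / y * h" .
      have 2: "\<bar>\<xi> (t - s) - \<xi> (t - s0)\<bar> \<le> \<rho>"
        using st s ss s01 by (intro \<rho>(2)) (auto simp flip: h_def)
      have "cmod ((w s - w s0) - of_real (\<xi> (t - s) - \<xi> (t - s0))) \<le> 2 / y * h + \<rho>"
        using norm_triangle_ineq4[of "w s - w s0" "of_real (\<xi> (t - s) - \<xi> (t - s0))"] 1 2
        unfolding norm_of_real by linarith
      moreover have "(w s - w s0) - of_real (\<xi> (t - s) - \<xi> (t - s0))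
          = (w s - of_real (\<xi> (t - s))) - (w s0 - of_real (\<xi> (t - s0)))" by simp
      ultimately have 3: "cmod ((w s - of_real (\<xi> (t - s))) - (w s0 - of_real (\<xi> (t - s0)))) \<le> 2 / y * h + \<rho>"
        by (simp only:)
      have "cmod (v s - v s0) \<le> cmod (- 2) / y\<^sup>2 * cmod ((w s - of_real (\<xi> (t - s))) - (w s0 - of_real (\<xi> (t - s0))))"
        unfolding v_def using wIm[OF st] wIm[OF s(1)] y by (intro norm_inverse_diff_le) auto
      also have "\<dots> \<le> cmod (- 2) / y\<^sup>2 * (2 / y * h + \<rho>)" by (intro mult_left_mono 3) auto
      finally show "cmod (v s - v s0) \<le> c" unfolding c_def L_def by simp
    qed
    then have lin: "cmod (w s1 - w s0 - h *\<^sub>R v s0) \<le> h * c" using s01 h by simp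
    define V where "V = - 2 / (W k - of_real (\<xi> (t - s0)))"
    have Wstep: "W (Suc k) = W k + h *\<^sub>R V"
    proof -
      have "W k - of_real (\<xi> (t - s0)) = euler_flow h (reverse_increment \<xi> t n) z k"
        unfolding W_def s0_def by simp
      moreover have "reverse_increment \<xi> t n k = \<xi> (t - s0) - \<xi> (t - s1)"
        unfolding reverse_increment_def s0_def s1_def h_def by simp
      ultimately show ?thesis
        unfolding V_def W_def by (simp add: s0_def s1_def scaleR_conv_of_real)
    qed
    have "cmod (V - v s0) \<le> cmod (- 2) / y\<^sup>2 * cmod ((W k - of_real (\<xi> (t - s0))) - (w s0 - of_real (\<xi> (t - s0))))"
      unfolding v_def V_def using wIm[OF s(1)] WIm[of k] y by (intro norm_inverse_diff_le) auto
    then have Vv: "cmod (V - v s0) \<le> L * cmod (W k - w s0)" unfolding L_def by simp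
    have "W (Suc k) - w s1 = (W k - w s0) + h *\<^sub>R (V - v s0) - (w s1 - w s0 - h *\<^sub>R v s0)"
      unfolding Wstep by (simp add: scaleR_diff_right)
    also have "cmod \<dots> \<le> cmod (W k - w s0) + h * cmod (V - v s0) + h * c"
      using norm_triangle_ineq4[of "(W k - w s0) + h *\<^sub>R (V - v s0)" "w s1 - w s0 - h *\<^sub>R v s0"]
        norm_triangle_ineq[of "W k - w s0" "h *\<^sub>R (V - v s0)"] lin h by simp
    also have "\<dots> \<le> cmod (W k - w s0) + h * (L * cmod (W k - w s0)) + h * c"
      using Vv h by (simp add: mult_left_mono)
    also have "\<dots> = (1 + L * h) * cmod (W k - w s0) + h * c * 1" by (simp add: algebra_simps)
    also have "\<dots> \<le> (1 + L * h) * (k * h * c * (1 + L * h) ^ k) + h * c * (1 + L * h) ^ Suc k"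
      using Suc L h c unfolding s0_def
      by (intro add_mono mult_left_mono one_le_power) auto
    also have "\<dots> = Suc k * h * c * (1 + L * h) ^ Suc k" by (simp add: algebra_simps)
    finally show ?case unfolding s1_def .
  qed
  have "cmod (W n - w t) \<le> t * c * (1 + L * h) ^ n" using err[of n] h by simp
  also have "(1 + L * h) ^ n \<le> exp (L * h) ^ n"
    using L h by (intro power_mono) (auto simp: exp_ge_add_one_self)
  also have "exp (L * h) ^ n = exp (L * t)"
    using h by (simp add: exp_of_nat_mult[symmetric] mult.left_commute)
  finally have "cmod (W n - w t) \<le> t * c * exp (L * t)" using t c by (simp add: mult_left_mono)
  then show ?thesis unfolding W_def using h unfolding c_def L_def by (simp add: h_def)
qed

lemma reverse_flow_representation:
  fixes \<xi> :: "real \<Rightarrow> real"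
  assumes \<xi>: "continuous_on {0..} \<xi>" and t: "0 \<le> t" and z: "0 < Im z"
  obtains w where "w 0 = z + of_real (\<xi> t)" "w t = loewner_fhat \<xi> t z"
    "\<And>s. s \<in> {0..t} \<Longrightarrow> Im z \<le> Im (w s)"
    "\<And>s. s \<in> {0..t} \<Longrightarrow>
      (w has_vector_derivative - 2 / (w s - of_real (\<xi> (t - s)))) (at s within {0..t})"
proof -
  have "continuous_on {0..t} (\<lambda>s. \<xi> (t - s))"
    by (rule continuous_on_compose2[OF \<xi>]) (auto intro!: continuous_intros)
  then obtain w where w: "w 0 = z + of_real (\<xi> t)" "\<And>s. s \<in> {0..t} \<Longrightarrow> Im z \<le> Im (w s)"
    "\<And>s. s \<in> {0..t} \<Longrightarrow> (w has_vector_derivative - 2 / (w s - of_real (\<xi> (t - s)))) (at s within {0..t})"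
    using reverse_loewner_solution[OF t, of "z + of_real (\<xi> t)" "\<lambda>s. \<xi> (t - s)"] z by auto
  from loewner_fhat_reverse[OF \<xi> t z w] w show thesis by (intro that[of w]) auto
qed

text \<open>Along the reverse flow the derivative of \<open>(Im w)\<^sup>2\<close> is \<open>4 * (Im w)\<^sup>2 / \<bar>w - \<xi>\<bar>\<^sup>2 \<le> 4\<close>.\<close>

lemma Im_loewner_fhat_bounds:
  fixes \<xi> :: "real \<Rightarrow> real"
  assumes \<xi>: "continuous_on {0..} \<xi>" and t: "0 \<le> t" and z: "0 < Im z"
  shows "Im z \<le> Im (loewner_fhat \<xi> t z)" "(Im (loewner_fhat \<xi> t z))\<^sup>2 \<le> (Im z)\<^sup>2 + 4 * t"
proof -
  obtain w where w: "w 0 = z + of_real (\<xi> t)" "w t = loewner_fhat \<xi> t z"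
    "\<And>s. s \<in> {0..t} \<Longrightarrow> Im z \<le> Im (w s)"
    "\<And>s. s \<in> {0..t} \<Longrightarrow> (w has_vector_derivative - 2 / (w s - of_real (\<xi> (t - s)))) (at s within {0..t})"
    by (rule reverse_flow_representation[OF \<xi> t z]) (rule that)
  show "Im z \<le> Im (loewner_fhat \<xi> t z)" using w(2) w(3)[of t] t by simp
  define I where "I s = Im (w s)" for s
  define g where "g s = 4 * s - (I s)\<^sup>2" for s
  define d where "d s = Im (- 2 / (w s - of_real (\<xi> (t - s))))" for s
  have "g 0 \<le> g t"
  proof (rule nonneg_derivative_imp_ge_start[where g' = "\<lambda>s. 4 - 2 * I s * d s" and T = t])
    fix s assume s: "s \<in> {0..t}"
    have "(I has_real_derivative d s) (at s within {0..t})"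
      using bounded_linear.has_vector_derivative[OF bounded_linear_Im w(4)[OF s]]
      unfolding d_def I_def has_real_derivative_iff_has_vector_derivative .
    then have "(g has_real_derivative 4 - 2 * I s * d s) (at s within {0..t})"
      unfolding g_def by (auto intro!: derivative_eq_intros)
    then show "(g has_vector_derivative 4 - 2 * I s * d s) (at s within {0..t})"
      unfolding has_real_derivative_iff_has_vector_derivative .
    define X where "X = Re (w s) - \<xi> (t - s)"
    have Y: "0 < Im (w s)" using w(3)[OF s] z by simp
    have "d s = 2 * Im (w s) / (X\<^sup>2 + (Im (w s))\<^sup>2)"
      unfolding d_def X_def by (simp add: Im_divide)
    then have "Im (w s) * d s = 2 * ((Im (w s))\<^sup>2 / (X\<^sup>2 + (Im (w s))\<^sup>2))"
      by (simp add: power2_eq_square)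
    also have "(Im (w s))\<^sup>2 / (X\<^sup>2 + (Im (w s))\<^sup>2) \<le> 1"
      using Y by (simp add: add_nonneg_pos)
    finally show "0 \<le> 4 - 2 * I s * d s" unfolding I_def by (simp add: mult.commute)
  qed (use t in auto)
  then show "(Im (loewner_fhat \<xi> t z))\<^sup>2 \<le> (Im z)\<^sup>2 + 4 * t"
    unfolding g_def I_def using w(1,2) by simp
qed

lemma euler_flow_uniform_limit:
  fixes \<xi> :: "real \<Rightarrow> real"
  assumes \<xi>: "continuous_on {0..} \<xi>" and t: "0 \<le> t" and y: "0 < y"
  shows "uniform_limit {z. y < Im z}
    (\<lambda>n z. euler_flow (t / n) (reverse_increment \<xi> t n) z n + of_real (\<xi> 0)) (loewner_fhat \<xi> t) sequentially"
proof (rule uniform_limitI)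
  fix e :: real assume e: "e > 0"
  define A where "A = t * (2 / y\<^sup>2) * exp (2 / y\<^sup>2 * t)"
  have A: "A \<ge> 0" unfolding A_def using t by simp
  define \<rho> where "\<rho> = e / (2 * (A + 1))"
  have \<rho>: "\<rho> > 0" unfolding \<rho>_def using e A by simp
  have "uniformly_continuous_on {0..t} \<xi>"
    by (intro compact_uniformly_continuous continuous_on_subset[OF \<xi>]) auto
  then obtain d where d: "d > 0" "\<And>r r'. r \<in> {0..t} \<Longrightarrow> r' \<in> {0..t} \<Longrightarrow> dist r' r < d \<Longrightarrow> dist (\<xi> r') (\<xi> r) < \<rho>"
    using \<rho> unfolding uniformly_continuous_on_def by metis
  have lim: "(\<lambda>n. t / real n) \<longlonglongrightarrow> 0" by (rule lim_const_over_n)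
  have lim2: "(\<lambda>n. 2 / y * (t / real n)) \<longlonglongrightarrow> 2 / y * 0" by (intro tendsto_intros lim)
  have "\<forall>\<^sub>F n in sequentially. t / real n < d" by (rule order_tendstoD(2)[OF lim d(1)])
  moreover have "\<forall>\<^sub>F n in sequentially. 2 / y * (t / real n) < \<rho>" by (rule order_tendstoD(2)[OF lim2]) (use \<rho> in simp)
  moreover have "\<forall>\<^sub>F n in sequentially. n > 0" by (rule eventually_gt_at_top)
  ultimately show "\<forall>\<^sub>F n in sequentially. \<forall>z\<in>{z. y < Im z}.
      dist (euler_flow (t / n) (reverse_increment \<xi> t n) z n + of_real (\<xi> 0)) (loewner_fhat \<xi> t z) < e"
  proof eventually_elim
    case (elim n)
    show ?case
    proof
      fix z assume "z \<in> {z. y < Im z}"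
      then have z: "y \<le> Im z" "0 < Im z" using y by auto
      obtain w where w: "w 0 = z + of_real (\<xi> t)" "w t = loewner_fhat \<xi> t z"
        "\<And>s. s \<in> {0..t} \<Longrightarrow> Im z \<le> Im (w s)"
        "\<And>s. s \<in> {0..t} \<Longrightarrow> (w has_vector_derivative - 2 / (w s - of_real (\<xi> (t - s)))) (at s within {0..t})"
        by (rule reverse_flow_representation[OF \<xi> t z(2)]) (rule that)
      have "\<bar>\<xi> r - \<xi> r'\<bar> \<le> \<rho>" if "r \<in> {0..t}" "r' \<in> {0..t}" "\<bar>r - r'\<bar> \<le> t / n" for r r'
        using d(2)[of r' r] that elim by (auto simp: dist_real_def)
      from euler_flow_error[OF t elim(3) y z(1) w(1,3,4) less_imp_le[OF \<rho>] this]
      have "dist (euler_flow (t / n) (reverse_increment \<xi> t n) z n + of_real (\<xi> 0)) (loewner_fhat \<xi> t z)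
          \<le> A * (2 / y * (t / n) + \<rho>)"
        unfolding dist_norm w(2)[symmetric] A_def by (simp only: mult_ac)
      also have "\<dots> \<le> A * (2 * \<rho>)" using elim A by (intro mult_left_mono) auto
      also have "\<dots> < (A + 1) * (2 * \<rho>)" using \<rho> by simp
      also have "\<dots> = e" unfolding \<rho>_def using A by (simp add: field_simps)
      finally show "dist (euler_flow (t / n) (reverse_increment \<xi> t n) z n + of_real (\<xi> 0)) (loewner_fhat \<xi> t z) < e" .
    qed
  qed
qed

text \<open>Uniform convergence of holomorphic functions on an open set carries over to their derivatives.\<close>

lemma euler_flow_converges:
  fixes \<xi> :: "real \<Rightarrow> real"
  assumes \<xi>: "continuous_on {0..} \<xi>" and t: "0 \<le> t" and z: "0 < Im z"
  shows "(\<lambda>n. euler_flow (t / n) (reverse_increment \<xi> t n) z n + of_real (\<xi> 0)) \<longlonglongrightarrow> loewner_fhat \<xi> t z"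
    and "(\<lambda>n. euler_deriv (t / n) (reverse_increment \<xi> t n) z n) \<longlonglongrightarrow> deriv (loewner_fhat \<xi> t) z"
proof -
  define A where "A = {x. Im z / 2 < Im x}"
  have zA: "z \<in> A" unfolding A_def using z by simp
  have oA: "open A" unfolding A_def by (rule open_halfspace_Im_gt)
  have ul: "uniform_limit A (\<lambda>n z. euler_flow (t / n) (reverse_increment \<xi> t n) z n + of_real (\<xi> 0))
      (loewner_fhat \<xi> t) sequentially"
    unfolding A_def using euler_flow_uniform_limit[OF \<xi> t, of "Im z / 2"] z by simp
  have der: "((\<lambda>z. euler_flow (t / n) (reverse_increment \<xi> t n) z n + of_real (\<xi> 0)) has_field_derivative
      euler_deriv (t / n) (reverse_increment \<xi> t n) x n) (at x)" if "x \<in> A" for n x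
    using has_field_derivative_euler_flow[of "t / n" x "reverse_increment \<xi> t n" n] that t z
    unfolding A_def by (auto intro!: derivative_eq_intros)
  show "(\<lambda>n. euler_flow (t / n) (reverse_increment \<xi> t n) z n + of_real (\<xi> 0)) \<longlonglongrightarrow> loewner_fhat \<xi> t z"
    by (rule tendsto_uniform_limitI[OF ul zA])
  have "(\<lambda>n. deriv (\<lambda>z. euler_flow (t / n) (reverse_increment \<xi> t n) z n + of_real (\<xi> 0)) z)
      \<longlonglongrightarrow> deriv (loewner_fhat \<xi> t) z"
  proof (rule deriv_complex_uniform_limit[OF ul _ _ oA zA])
    show "\<forall>\<^sub>F n in sequentially. (\<lambda>z. euler_flow (t / n) (reverse_increment \<xi> t n) z n + of_real (\<xi> 0)) holomorphic_on A"
      unfolding holomorphic_on_open[OF oA] using der by (intro always_eventually allI ballI) blast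
  qed simp
  then show "(\<lambda>n. euler_deriv (t / n) (reverse_increment \<xi> t n) z n) \<longlonglongrightarrow> deriv (loewner_fhat \<xi> t) z"
    using DERIV_imp_deriv[OF der[OF zA]] by simp
qed

lemma norm_deriv_loewner_fhat_le:
  fixes \<xi> :: "real \<Rightarrow> real"
  assumes \<xi>: "continuous_on {0..} \<xi>" and t: "0 \<le> t" and z: "0 < Im z"
  shows "cmod (deriv (loewner_fhat \<xi> t) z) * Im z \<le> Im (loewner_fhat \<xi> t z)"
proof (rule LIMSEQ_le)
  show "(\<lambda>n. cmod (euler_deriv (t / n) (reverse_increment \<xi> t n) z n) * Im z)
      \<longlonglongrightarrow> cmod (deriv (loewner_fhat \<xi> t) z) * Im z"
    by (intro tendsto_intros euler_flow_converges[OF \<xi> t z])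
  show "(\<lambda>n. Im (euler_flow (t / n) (reverse_increment \<xi> t n) z n + of_real (\<xi> 0))) \<longlonglongrightarrow> Im (loewner_fhat \<xi> t z)"
    by (intro tendsto_intros euler_flow_converges[OF \<xi> t z])
  show "\<exists>N. \<forall>n\<ge>N. cmod (euler_deriv (t / n) (reverse_increment \<xi> t n) z n) * Im z
      \<le> Im (euler_flow (t / n) (reverse_increment \<xi> t n) z n + of_real (\<xi> 0))"
    using norm_euler_deriv_le[of _ z] t z by auto
qed

section \<open>Moments of the inverse map under Brownian driving\<close>

text \<open>The forward increments are independent centred Gaussians; reversing their order leaves the law of an
  i.i.d. vector unchanged.\<close>

lemma (in standard_brownian_motion) distr_scaled_reverse_increments:
  assumes t: "0 < t" and n: "0 < n"
  shows "distr M (Pi\<^sub>M {..<n} (\<lambda>_. borel))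
      (\<lambda>\<omega>. \<lambda>k\<in>{..<n}. reverse_increment (\<lambda>s. B s \<omega>) t n k / sqrt (t / n))
    = Pi\<^sub>M {..<n} (\<lambda>_. std_gaussian)"
proof -
  define h where "h = t / n"
  have h: "0 < h" "n * h = t" unfolding h_def using t n by auto
  define X where "X i \<omega> = (B (real (Suc i) * h) \<omega> - B (real i * h) \<omega>) / sqrt h" for i \<omega>
  have gap: "real (Suc i) * h - real i * h = h" for i by (simp add: algebra_simps)
  have dist: "distributed M lborel (X i) std_normal_density" for i
  proof -
    have "distributed M lborel (\<lambda>\<omega>. B (real (Suc i) * h) \<omega> - B (real i * h) \<omega>) (normal_density 0 (sqrt h))"
      using gaussian_increments[of "real i * h" "real (Suc i) * h"] h gap[of i] by simp
    then show ?thesis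
      using h unfolding X_def by (subst (asm) normal_standard_normal_convert) simp_all
  qed
  have law: "distr M borel (X i) = std_gaussian" for i
  proof -
    have "distr M borel (X i) = distr M lborel (X i)" by (rule distr_cong) simp_all
    then show ?thesis using distributed_distr_eq_density[OF dist] by simp
  qed
  have rv: "random_variable borel (X i)" for i
    using distributed_measurable[OF dist[of i]] by simp
  have "indep_vars (\<lambda>_. borel) (\<lambda>i \<omega>. B (real (Suc i) * h) \<omega> - B (real i * h) \<omega>) {..<n}"
    using h by (intro independent_increments) auto
  then have "indep_vars (\<lambda>_. borel) X {..<n}"
    unfolding X_def by (rule indep_vars_compose2) simp
  then have "distr M (Pi\<^sub>M {..<n} (\<lambda>_. borel)) (\<lambda>\<omega>. \<lambda>i\<in>{..<n}. X i \<omega>) = (\<Pi>\<^sub>M i\<in>{..<n}. distr M borel (X i))"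
    using n rv by (subst (asm) indep_vars_iff_distr_eq_PiM') auto
  also have "\<dots> = Pi\<^sub>M {..<n} (\<lambda>_. std_gaussian)" unfolding law ..
  finally have joint: "distr M (Pi\<^sub>M {..<n} (\<lambda>_. borel)) (\<lambda>\<omega>. \<lambda>i\<in>{..<n}. X i \<omega>) = Pi\<^sub>M {..<n} (\<lambda>_. std_gaussian)" .
  define rev where "rev x = (\<lambda>k\<in>{..<n}. x (n - 1 - k))" for x :: "nat \<Rightarrow> real"
  have revm: "rev \<in> measurable (Pi\<^sub>M {..<n} (\<lambda>_. borel)) (Pi\<^sub>M {..<n} (\<lambda>_. borel))"
    unfolding rev_def by (intro measurable_restrict measurable_component_singleton) auto
  have Xm: "(\<lambda>\<omega>. \<lambda>i\<in>{..<n}. X i \<omega>) \<in> measurable M (Pi\<^sub>M {..<n} (\<lambda>_. borel))"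
    using rv by (intro measurable_restrict) auto
  have "(\<lambda>\<omega>. \<lambda>k\<in>{..<n}. reverse_increment (\<lambda>s. B s \<omega>) t n k / sqrt (t / n)) = rev \<circ> (\<lambda>\<omega>. \<lambda>i\<in>{..<n}. X i \<omega>)"
  proof (intro ext)
    fix \<omega> k
    show "(\<lambda>k\<in>{..<n}. reverse_increment (\<lambda>s. B s \<omega>) t n k / sqrt (t / n)) k = (rev \<circ> (\<lambda>\<omega>. \<lambda>i\<in>{..<n}. X i \<omega>)) \<omega> k"
    proof (cases "k < n")
      case True
      have "real (Suc (n - 1 - k)) * h = t - real k * (t / n)" "real (n - 1 - k) * h = t - real (Suc k) * (t / n)"
        using True h(2) unfolding h_def[symmetric] by (auto simp: of_nat_diff algebra_simps)
      then show ?thesis using True unfolding rev_def reverse_increment_def X_def h_def[symmetric] by simp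
    qed (simp add: rev_def)
  qed
  then have "distr M (Pi\<^sub>M {..<n} (\<lambda>_. borel)) (\<lambda>\<omega>. \<lambda>k\<in>{..<n}. reverse_increment (\<lambda>s. B s \<omega>) t n k / sqrt (t / n))
      = distr (Pi\<^sub>M {..<n} (\<lambda>_. std_gaussian)) (Pi\<^sub>M {..<n} (\<lambda>_. borel)) rev"
    unfolding joint[symmetric] using distr_distr[OF revm Xm] by simp
  also have "\<dots> = distr (Pi\<^sub>M {..<n} (\<lambda>_. std_gaussian)) (Pi\<^sub>M {..<n} (\<lambda>_. std_gaussian)) rev"
    by (intro distr_cong refl sets_PiM_cong) simp
  also have "\<dots> = Pi\<^sub>M {..<n} (\<lambda>_. std_gaussian)"
    unfolding rev_def
    by (rule distr_PiM_reindex) (auto simp: prob_space_std_gaussian inj_on_def)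
  finally show ?thesis .
qed

lemma (in standard_brownian_motion) reverse_increment_measurable:
  assumes "0 \<le> t" "k < n"
  shows "(\<lambda>\<omega>. reverse_increment (\<lambda>s. \<sigma> * B s \<omega>) t n k) \<in> borel_measurable M"
proof -
  have "0 \<le> t - real j * (t / real n)" if "j \<le> n" for j
  proof -
    have "real j * (t / n) \<le> real n * (t / n)" using that assms by (intro mult_right_mono) auto
    then show ?thesis using assms by simp
  qed
  from this[of k] this[of "Suc k"] assms show ?thesis
    unfolding reverse_increment_def by (intro borel_measurable_diff borel_measurable_times random_variable) auto
qed

lemma (in standard_brownian_motion) euler_measurable:
  assumes "0 \<le> t"
  shows "(\<lambda>\<omega>. euler_flow (t / n) (reverse_increment (\<lambda>s. \<sigma> * B s \<omega>) t n) z n) \<in> borel_measurable M"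
    and "(\<lambda>\<omega>. euler_deriv (t / n) (reverse_increment (\<lambda>s. \<sigma> * B s \<omega>) t n) z n) \<in> borel_measurable M"
  by (intro euler_flow_measurable reverse_increment_measurable assms; assumption)+

lemma (in standard_brownian_motion) path_continuous:
  assumes "\<omega> \<in> space M"
  shows "continuous_on {0..} (\<lambda>s. \<sigma> * B s \<omega>)"
  using continuous_paths[OF assms] by (intro continuous_intros)

lemma (in standard_brownian_motion) deriv_loewner_fhat_measurable:
  assumes "0 \<le> t" "0 < Im z"
  shows "(\<lambda>\<omega>. deriv (loewner_fhat (\<lambda>s. \<sigma> * B s \<omega>) t) z) \<in> borel_measurable M"
  by (rule borel_measurable_LIMSEQ_metric[OF euler_measurable(2)[OF assms(1)]])
     (rule euler_flow_converges(2)[OF path_continuous assms])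

text \<open>A factor \<open>1 + O(h powr (3/2))\<close> per step is harmless: with \<open>n\<close> steps of size \<open>1 / n\<close> the exponent is
  \<open>n * n powr (-3/2) = 1 / sqrt n\<close>.\<close>

lemma one_plus_power_tendsto_1:
  fixes c :: real
  assumes "0 \<le> c"
  shows "(\<lambda>n. (1 + c * (1 / sqrt (real n)) ^ 3) ^ n) \<longlonglongrightarrow> 1"
proof (rule tendsto_sandwich[of "\<lambda>_. 1" _ _ "\<lambda>n. exp (c / sqrt (real n))"])
  have le: "(1 + c * (1 / sqrt (real n)) ^ 3) ^ n \<le> exp (c / sqrt (real n))" if "n > 0" for n
  proof -
    have "(1 + c * (1 / sqrt (real n)) ^ 3) ^ n \<le> exp (c * (1 / sqrt (real n)) ^ 3) ^ n"
      using assms by (intro power_mono exp_ge_add_one_self) auto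
    also have "\<dots> = exp (real n * (c * (1 / sqrt (real n)) ^ 3))" by (rule exp_of_nat_mult[symmetric])
    also have "real n * (c * (1 / sqrt (real n)) ^ 3) = c / sqrt (real n)"
    proof -
      have "sqrt (real n) > 0" "real n = sqrt (real n) * sqrt (real n)" using that by auto
      then show ?thesis by (simp add: power3_eq_cube field_simps)
    qed
    finally show ?thesis .
  qed
  then show "\<forall>\<^sub>F n in sequentially. (1 + c * (1 / sqrt (real n)) ^ 3) ^ n \<le> exp (c / sqrt (real n))"
    by (auto intro: eventually_mono[OF eventually_gt_at_top[of 0]])
  show "\<forall>\<^sub>F n in sequentially. 1 \<le> (1 + c * (1 / sqrt (real n)) ^ 3) ^ n"
    using assms by (intro always_eventually allI one_le_power) auto
  have "(\<lambda>n. c / sqrt (real n)) \<longlonglongrightarrow> 0"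
    by (intro tendsto_divide_0[OF tendsto_const] filterlim_at_top_imp_at_infinity
        filterlim_compose[OF sqrt_at_top filterlim_real_sequentially])
  then have "(\<lambda>n. exp (c / sqrt (real n))) \<longlonglongrightarrow> exp 0" by (rule tendsto_exp)
  then show "(\<lambda>n. exp (c / sqrt (real n))) \<longlonglongrightarrow> 1" by simp
qed simp

lemma flow_weight_ge:
  assumes "0 \<le> b" "0 < Im Z"
  shows "cmod D powr a * Im Z powr (c + 2 * b) \<le> flow_weight a c b D Z"
proof -
  have "(Im Z)\<^sup>2 powr b \<le> (cmod Z)\<^sup>2 powr b"
    using assms abs_Im_le_cmod[of Z] by (intro powr_mono2 power_mono) auto
  moreover have "(Im Z)\<^sup>2 powr b = Im Z powr (2 * b)"
    using powr_half_of_square[of "Im Z" "2 * b"] assms by simp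
  ultimately have "cmod D powr a * Im Z powr c * Im Z powr (2 * b) \<le> flow_weight a c b D Z"
    unfolding flow_weight_def by (intro mult_left_mono) auto
  then show ?thesis by (simp add: powr_add mult.assoc)
qed

text \<open>Fatou's lemma along the Euler approximations. At \<open>t = 0\<close> the increments are degenerate, but then the
  map is a translation and the claim is an equality.\<close>

lemma (in standard_brownian_motion) loewner_fhat_moment_bound:
  fixes \<kappa> b :: real
  assumes \<kappa>: "0 \<le> \<kappa>" and b: "0 \<le> b" and t: "0 \<le> t" and y: "0 < y"
  defines "a \<equiv> 2 * b + \<kappa> * b * (1 - b) / 2" and "c \<equiv> - \<kappa> * b\<^sup>2 / 2"
  assumes a: "0 < a"
  shows "(\<integral>\<^sup>+ \<omega>. ennreal (cmod (deriv (loewner_fhat (\<lambda>s. sqrt \<kappa> * B s \<omega>) t) (\<i> * of_real y)) powr a *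
      Im (loewner_fhat (\<lambda>s. sqrt \<kappa> * B s \<omega>) t (\<i> * of_real y)) powr (c + 2 * b)) \<partial>M) \<le> ennreal (y powr (c + 2 * b))"
proof -
  define e where "e = c + 2 * b"
  define z where "z = \<i> * of_real y"
  have z: "0 < Im z" "Im z = y" unfolding z_def using y by auto
  define \<xi> where "\<xi> \<omega> s = sqrt \<kappa> * B s \<omega>" for \<omega> s
  define D where "D n \<omega> = euler_deriv (t / n) (reverse_increment (\<xi> \<omega>) t n) z n" for n \<omega>
  define Z where "Z n \<omega> = euler_flow (t / n) (reverse_increment (\<xi> \<omega>) t n) z n" for n \<omega>
  define \<Psi> where "\<Psi> n \<omega> = cmod (D n \<omega>) powr a * Im (Z n \<omega>) powr e" for n \<omega>
  define \<Phi> where "\<Phi> \<omega> = cmod (deriv (loewner_fhat (\<xi> \<omega>) t) z) powr a * Im (loewner_fhat (\<xi> \<omega>) t z) powr e" for \<omega>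
  have meas [measurable]: "D n \<in> borel_measurable M" "Z n \<in> borel_measurable M" for n
    unfolding D_def Z_def \<xi>_def by (intro euler_measurable[OF t])+
  have ZIm: "y \<le> Im (Z n \<omega>)" for n \<omega>
    unfolding Z_def using Im_euler_flow_ge[of "t / n" z] t z by simp
  have conv: "(\<lambda>n. \<Psi> n \<omega>) \<longlonglongrightarrow> \<Phi> \<omega>" if "\<omega> \<in> space M" for \<omega>
  proof -
    have c: "continuous_on {0..} (\<xi> \<omega>)" unfolding \<xi>_def by (rule path_continuous[OF that])
    have "(\<lambda>n. Im (Z n \<omega> + of_real (\<xi> \<omega> 0))) \<longlonglongrightarrow> Im (loewner_fhat (\<xi> \<omega>) t z)"
      unfolding Z_def by (intro tendsto_Im euler_flow_converges[OF c t z(1)])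
    then have i: "(\<lambda>n. Im (Z n \<omega>)) \<longlonglongrightarrow> Im (loewner_fhat (\<xi> \<omega>) t z)" by simp
    have d: "(\<lambda>n. cmod (D n \<omega>)) \<longlonglongrightarrow> cmod (deriv (loewner_fhat (\<xi> \<omega>) t) z)"
      unfolding D_def by (intro tendsto_norm euler_flow_converges[OF c t z(1)])
    have "Im (loewner_fhat (\<xi> \<omega>) t z) \<noteq> 0" using Im_loewner_fhat_bounds(1)[OF c t z(1)] z(1) by simp
    then show ?thesis unfolding \<Psi>_def \<Phi>_def using a
      by (intro tendsto_mult tendsto_powr[OF i] tendsto_powr'[OF d] tendsto_const) auto
  qed
  have "(\<integral>\<^sup>+ \<omega>. ennreal (\<Phi> \<omega>) \<partial>M) \<le> ennreal (y powr e)"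
  proof (cases "t = 0")
    case True
    have "\<Phi> \<omega> = y powr e" if "\<omega> \<in> space M" for \<omega>
    proof (rule LIMSEQ_unique[OF conv[OF that]])
      have "reverse_increment (\<xi> \<omega>) 0 n k = 0" for n k by (simp add: reverse_increment_def)
      then have "euler_flow 0 (reverse_increment (\<xi> \<omega>) 0 n) z k = z \<and> euler_deriv 0 (reverse_increment (\<xi> \<omega>) 0 n) z k = 1" for n k
        by (induction k) auto
      then have "\<Psi> n \<omega> = y powr e" for n
        unfolding \<Psi>_def D_def Z_def using True z by simp
      then show "(\<lambda>n. \<Psi> n \<omega>) \<longlonglongrightarrow> y powr e" by simp
    qed
    then have "(\<integral>\<^sup>+ \<omega>. ennreal (\<Phi> \<omega>) \<partial>M) = (\<integral>\<^sup>+ \<omega>. ennreal (y powr e) \<partial>M)"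
      by (intro nn_integral_cong) simp
    then show ?thesis by (simp add: emeasure_space_1)
  next
    case False
    then have t: "0 < t" using t by simp
    obtain K where K: "K > 0" and E: "\<And>h z k. 0 \<le> h \<Longrightarrow> 0 < Im z \<Longrightarrow> 16 * h \<le> (Im z)\<^sup>2 \<Longrightarrow>
      (\<integral>\<^sup>+ x. ennreal (flow_weight a c b
          (euler_deriv h (\<lambda>i. sqrt \<kappa> * sqrt h * x i) z k)
          (euler_flow h (\<lambda>i. sqrt \<kappa> * sqrt h * x i) z k)) \<partial>Pi\<^sub>M {..<k} (\<lambda>_. std_gaussian))
        \<le> ennreal (flow_weight a c b 1 z * (1 + K * (sqrt h / Im z) ^ 3) ^ k)"
      by (rule euler_flow_weight_bound[OF \<kappa> b, folded a_def c_def]) (rule that)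
    define C where "C = K * (sqrt t / y) ^ 3"
    have C: "0 \<le> C" unfolding C_def using K t y by simp
    define F where "F n = (1 + C * (1 / sqrt (real n)) ^ 3) ^ n" for n
    have bound: "(\<integral>\<^sup>+ \<omega>. ennreal (\<Psi> n \<omega>) \<partial>M) \<le> ennreal (y powr e * F n)" if n: "n > 0" "16 * (t / n) \<le> y\<^sup>2" for n
    proof -
      define h where "h = t / n"
      have h: "0 < h" unfolding h_def using n t by simp
      define N where "N \<omega> = (\<lambda>k\<in>{..<n}. reverse_increment (\<lambda>s. B s \<omega>) t n k / sqrt (t / n))" for \<omega>
      define G where "G x = ennreal (flow_weight a c b
          (euler_deriv h (\<lambda>i. sqrt \<kappa> * sqrt h * x i) z n)
          (euler_flow h (\<lambda>i. sqrt \<kappa> * sqrt h * x i) z n))" for x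
      have joint: "distr M (Pi\<^sub>M {..<n} (\<lambda>_. borel)) N = Pi\<^sub>M {..<n} (\<lambda>_. std_gaussian)"
        unfolding N_def by (rule distr_scaled_reverse_increments[OF t n(1)])
      have Nm: "N \<in> measurable M (Pi\<^sub>M {..<n} (\<lambda>_. borel))"
        unfolding N_def using reverse_increment_measurable[of t _ n 1] t
        by (intro measurable_restrict borel_measurable_divide) auto
      have Gm: "G \<in> borel_measurable (Pi\<^sub>M {..<n} (\<lambda>_. borel))"
        unfolding G_def
        by (intro measurable_compose[OF _ measurable_ennreal] measurable_flow_weight euler_flow_measurable) simp_all
      have same: "reverse_increment (\<xi> \<omega>) t n i = sqrt \<kappa> * sqrt h * N \<omega> i" if "i < n" for \<omega> i
      proof -
        have "reverse_increment (\<xi> \<omega>) t n i = sqrt \<kappa> * reverse_increment (\<lambda>s. B s \<omega>) t n i"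
          unfolding \<xi>_def reverse_increment_def by (simp add: right_diff_distrib)
        moreover have "sqrt h * N \<omega> i = reverse_increment (\<lambda>s. B s \<omega>) t n i"
          unfolding N_def h_def[symmetric] using that h by simp
        ultimately show ?thesis by (simp add: mult.assoc)
      qed
      have "(\<integral>\<^sup>+ \<omega>. ennreal (\<Psi> n \<omega>) \<partial>M) \<le> (\<integral>\<^sup>+ \<omega>. G (N \<omega>) \<partial>M)"
      proof (rule nn_integral_mono)
        fix \<omega>
        have cong: "euler_flow h (reverse_increment (\<xi> \<omega>) t n) z n = euler_flow h (\<lambda>i. sqrt \<kappa> * sqrt h * N \<omega> i) z n
            \<and> euler_deriv h (reverse_increment (\<xi> \<omega>) t n) z n = euler_deriv h (\<lambda>i. sqrt \<kappa> * sqrt h * N \<omega> i) z n"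
          by (rule euler_flow_cong) (rule same)
        have "\<Psi> n \<omega> \<le> flow_weight a c b (D n \<omega>) (Z n \<omega>)"
          unfolding \<Psi>_def e_def using ZIm[of n \<omega>] y by (intro flow_weight_ge b) simp
        also have "D n \<omega> = euler_deriv h (\<lambda>i. sqrt \<kappa> * sqrt h * N \<omega> i) z n"
          unfolding D_def h_def[symmetric] using cong by (rule conjunct2)
        also have "Z n \<omega> = euler_flow h (\<lambda>i. sqrt \<kappa> * sqrt h * N \<omega> i) z n"
          unfolding Z_def h_def[symmetric] using cong by (rule conjunct1)
        finally show "ennreal (\<Psi> n \<omega>) \<le> G (N \<omega>)" unfolding G_def by (rule ennreal_leI)
      qed
      also have "\<dots> = (\<integral>\<^sup>+ x. G x \<partial>distr M (Pi\<^sub>M {..<n} (\<lambda>_. borel)) N)"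
        using Gm by (intro nn_integral_distr[OF Nm, symmetric]) simp
      also have "\<dots> \<le> ennreal (flow_weight a c b 1 z * (1 + K * (sqrt h / Im z) ^ 3) ^ n)"
        unfolding joint G_def using h n(2) z unfolding h_def[symmetric] by (intro E) auto
      also have "flow_weight a c b 1 z = y powr e"
      proof -
        have "(cmod z)\<^sup>2 powr b = y powr (2 * b)"
          using powr_half_of_square[of y "2 * b"] y unfolding z_def by (simp add: norm_mult)
        then show ?thesis unfolding flow_weight_def e_def using z by (simp add: powr_add)
      qed
      also have "(1 + K * (sqrt h / Im z) ^ 3) ^ n = F n"
        unfolding F_def C_def h_def z(2) by (simp add: real_sqrt_divide power_divide power_mult_distrib mult.commute)
      finally show ?thesis .
    qed
    have "(\<integral>\<^sup>+ \<omega>. ennreal (\<Phi> \<omega>) \<partial>M) = (\<integral>\<^sup>+ \<omega>. liminf (\<lambda>n. ennreal (\<Psi> n \<omega>)) \<partial>M)"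
      using conv by (intro nn_integral_cong lim_imp_Liminf[symmetric] tendsto_ennrealI) auto
    also have "\<dots> \<le> liminf (\<lambda>n. (\<integral>\<^sup>+ \<omega>. ennreal (\<Psi> n \<omega>) \<partial>M))"
      by (rule nn_integral_liminf) (simp add: \<Psi>_def)
    also have "\<dots> \<le> liminf (\<lambda>n. ennreal (y powr e * F n))"
    proof (rule Liminf_mono)
      have "(\<lambda>n. 16 * (t / real n)) \<longlonglongrightarrow> 16 * 0" by (intro tendsto_intros lim_const_over_n)
      then have "\<forall>\<^sub>F n in sequentially. 16 * (t / real n) < y\<^sup>2" by (rule order_tendstoD(2)) (use y in simp)
      then show "\<forall>\<^sub>F n in sequentially. (\<integral>\<^sup>+ \<omega>. ennreal (\<Psi> n \<omega>) \<partial>M) \<le> ennreal (y powr e * F n)"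
        using eventually_gt_at_top[of 0] by eventually_elim (intro bound, auto)
    qed
    also have "\<dots> = ennreal (y powr e)"
    proof (rule lim_imp_Liminf)
      have "(\<lambda>n. y powr e * F n) \<longlonglongrightarrow> y powr e * 1"
        unfolding F_def by (intro tendsto_intros one_plus_power_tendsto_1 C)
      then show "(\<lambda>n. ennreal (y powr e * F n)) \<longlonglongrightarrow> ennreal (y powr e)"
        by (intro tendsto_ennrealI) simp
    qed simp
    finally show ?thesis .
  qed
  then show ?thesis unfolding \<Phi>_def \<xi>_def e_def z_def .
qed

section \<open>The tail of the derivative\<close>

text \<open>On the event the derivative is large, and by the Schwarz-type bound so is the imaginary part: it lies
  between \<open>y powr \<epsilon>\<close> and \<open>3\<close>. Both bounds are needed since the exponent \<open>e\<close> may have either sign.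
  Markov's inequality then applies with the lower bound \<open>m\<close> for the integrand.\<close>

lemma (in standard_brownian_motion) deriv_loewner_fhat_tail:
  fixes \<kappa> b :: real
  assumes \<kappa>: "0 \<le> \<kappa>" and b: "0 \<le> b" and t: "0 \<le> t" "t \<le> 1" and y: "0 < y" "y < 1" and \<epsilon>: "0 \<le> \<epsilon>"
  defines "a \<equiv> 2 * b + \<kappa> * b * (1 - b) / 2" and "e \<equiv> - \<kappa> * b\<^sup>2 / 2 + 2 * b"
  assumes a: "0 < a"
  shows "measure M {\<omega> \<in> space M.
      y powr (- (1 - \<epsilon>)) < cmod (deriv (loewner_fhat (\<lambda>s. sqrt \<kappa> * B s \<omega>) t) (\<i> * of_real y))}
    \<le> 3 powr \<bar>e\<bar> * y powr (a + e - \<epsilon> * (a + \<bar>e\<bar>))"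
proof -
  define D where "D \<omega> = deriv (loewner_fhat (\<lambda>s. sqrt \<kappa> * B s \<omega>) t) (\<i> * of_real y)" for \<omega>
  define Y where "Y \<omega> = Im (loewner_fhat (\<lambda>s. sqrt \<kappa> * B s \<omega>) t (\<i> * of_real y))" for \<omega>
  define E where "E = {\<omega> \<in> space M. y powr (- (1 - \<epsilon>)) < cmod (D \<omega>)}"
  define m where "m = y powr (- (1 - \<epsilon>) * a) * (y powr (\<epsilon> * \<bar>e\<bar>) / 3 powr \<bar>e\<bar>)"
  have z: "0 < Im (\<i> * of_real y)" using y by simp
  have [measurable]: "D \<in> borel_measurable M"
    unfolding D_def by (rule deriv_loewner_fhat_measurable[OF t(1) z])
  have E: "E \<in> sets M" unfolding E_def by measurable
  have m: "0 < m" unfolding m_def using y by simp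
  have low: "m \<le> cmod (D \<omega>) powr a * Y \<omega> powr e" if \<omega>: "\<omega> \<in> E" for \<omega>
  proof -
    have sp: "\<omega> \<in> space M" and big: "y powr (- (1 - \<epsilon>)) < cmod (D \<omega>)" using \<omega> unfolding E_def by auto
    note c = path_continuous[OF sp, of "sqrt \<kappa>"]
    have dY: "cmod (D \<omega>) * y \<le> Y \<omega>"
      unfolding D_def Y_def using norm_deriv_loewner_fhat_le[OF c t(1) z] by simp
    have "y powr \<epsilon> = y powr (- (1 - \<epsilon>)) * y" using y powr_mult_base[of y "\<epsilon> - 1"] by (simp add: mult.commute)
    also have "\<dots> \<le> cmod (D \<omega>) * y" using big y by (intro mult_right_mono) auto
    finally have Y1: "y powr \<epsilon> \<le> Y \<omega>" using dY by linarith
    then have Y0: "0 < Y \<omega>" using y by (smt (verit) powr_gt_zero)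
    have "(Y \<omega>)\<^sup>2 \<le> y\<^sup>2 + 4 * t" unfolding Y_def using Im_loewner_fhat_bounds(2)[OF c t(1) z] by simp
    also have "\<dots> \<le> 3\<^sup>2" using t y power_le_one[of y 2] by simp
    finally have Y2: "Y \<omega> \<le> 3" by (rule power2_le_imp_le) simp
    have "y powr (\<epsilon> * \<bar>e\<bar>) / 3 powr \<bar>e\<bar> \<le> Y \<omega> powr e"
    proof (cases "0 \<le> e")
      case True
      have "y powr (\<epsilon> * \<bar>e\<bar>) / 3 powr \<bar>e\<bar> \<le> y powr (\<epsilon> * \<bar>e\<bar>) / 1"
        by (intro divide_left_mono ge_one_powr_ge_zero) auto
      also have "\<dots> = (y powr \<epsilon>) powr e" using True by (simp add: powr_powr)
      also have "\<dots> \<le> Y \<omega> powr e" using Y1 True by (intro powr_mono2) auto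
      finally show ?thesis .
    next
      case False
      have "y powr (\<epsilon> * \<bar>e\<bar>) / 3 powr \<bar>e\<bar> \<le> 1 / 3 powr \<bar>e\<bar>"
        using y \<epsilon> by (intro divide_right_mono powr_le1) auto
      also have "\<dots> = 3 powr e" using False by (simp add: powr_minus_divide[symmetric])
      also have "\<dots> \<le> Y \<omega> powr e" using Y0 Y2 False by (intro powr_mono2') auto
      finally show ?thesis .
    qed
    moreover have "y powr (- (1 - \<epsilon>) * a) \<le> cmod (D \<omega>) powr a"
      unfolding powr_powr[symmetric] using big a by (intro powr_mono2) auto
    ultimately show ?thesis unfolding m_def by (intro mult_mono) auto
  qed
  have "ennreal m * emeasure M E = (\<integral>\<^sup>+ \<omega>. ennreal m * indicator E \<omega> \<partial>M)"
    using E by (simp add: nn_integral_cmult_indicator)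
  also have "\<dots> \<le> (\<integral>\<^sup>+ \<omega>. ennreal (cmod (D \<omega>) powr a * Y \<omega> powr e) \<partial>M)"
    using low by (intro nn_integral_mono) (auto split: split_indicator intro: ennreal_leI)
  also have "\<dots> \<le> ennreal (y powr e)"
    unfolding D_def Y_def e_def a_def
    using loewner_fhat_moment_bound[OF \<kappa> b t(1) y(1)] a unfolding a_def by simp
  finally have "ennreal (m * measure M E) \<le> ennreal (y powr e)"
    using m by (simp add: emeasure_eq_measure ennreal_mult)
  then have "measure M E \<le> y powr e / m"
    using m by (simp add: ennreal_le_iff field_simps)
  also have "\<dots> = 3 powr \<bar>e\<bar> * y powr (a + e - \<epsilon> * (a + \<bar>e\<bar>))"
  proof -
    have "m * y powr (a + e - \<epsilon> * (a + \<bar>e\<bar>)) * 3 powr \<bar>e\<bar> = y powr (- (1 - \<epsilon>) * a + \<epsilon> * \<bar>e\<bar> + (a + e - \<epsilon> * (a + \<bar>e\<bar>)))"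
      unfolding m_def powr_add by simp
    also have "- (1 - \<epsilon>) * a + \<epsilon> * \<bar>e\<bar> + (a + e - \<epsilon> * (a + \<bar>e\<bar>)) = e" by (simp add: algebra_simps)
    finally show ?thesis using m by (simp add: field_simps)
  qed
  finally show ?thesis unfolding E_def D_def .
qed

theorem theorem1p3:
  fixes \<kappa> :: real and M :: "'a measure" and B :: "real \<Rightarrow> 'a \<Rightarrow> real"
  assumes "\<kappa> > 0" and "\<kappa> \<noteq> 8"
    and "standard_brownian_motion M B"
  shows "\<exists>\<epsilon>>0. \<exists>\<delta>>0. \<exists>C>0. \<forall>t\<in>{0..1}. \<forall>y\<in>{0<..<1}.
    (let E = {\<omega> \<in> space M.
        norm (deriv (loewner_fhat (\<lambda>s. sqrt \<kappa> * B s \<omega>) t) (\<i> * of_real y)) > y powr (- (1 - \<epsilon>))}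
     in E \<in> sets M \<and> measure M E \<le> C * y powr (2 + \<delta>))"
proof -
  interpret standard_brownian_motion M B by (rule assms(3))
  \<comment> \<open>the maximiser of \<open>a + e = 4 * b + \<kappa> * b / 2 - \<kappa> * b\<^sup>2\<close>\<close>
  define b where "b = (8 + \<kappa>) / (4 * \<kappa>)"
  define a where "a = 2 * b + \<kappa> * b * (1 - b) / 2"
  define e where "e = - \<kappa> * b\<^sup>2 / 2 + 2 * b"
  have b: "0 < b" unfolding b_def using assms by simp
  have a_eq: "a = b * (1 + 3 * \<kappa> / 8)" unfolding a_def b_def using assms by (simp add: field_simps)
  have a: "0 < a" unfolding a_eq using b assms by (intro mult_pos_pos) auto
  have lam: "a + e - 2 = (\<kappa> - 8)\<^sup>2 / (16 * \<kappa>)"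
    unfolding a_def e_def b_def using assms by (simp add: field_simps power2_eq_square)
  have lam0: "0 < a + e - 2" unfolding lam using assms by simp
  \<comment> \<open>half of the gain \<open>a + e - 2\<close> is spent on the loss \<open>\<epsilon> * (a + \<bar>e\<bar>)\<close>, the other half is \<open>\<delta>\<close>\<close>
  define \<epsilon> where "\<epsilon> = (a + e - 2) / (2 * (a + \<bar>e\<bar>))"
  define \<delta> where "\<delta> = (a + e - 2) / 2"
  have \<epsilon>: "0 < \<epsilon>" unfolding \<epsilon>_def using lam0 a by (intro divide_pos_pos) auto
  have \<delta>: "0 < \<delta>" unfolding \<delta>_def using lam0 by simp
  have ex: "a + e - \<epsilon> * (a + \<bar>e\<bar>) = 2 + \<delta>"
  proof -
    have "u / (2 * v) * v = u / 2" if "0 < v" for u v :: real using that by (simp add: field_simps)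
    from this[of "a + \<bar>e\<bar>"] have "\<epsilon> * (a + \<bar>e\<bar>) = (a + e - 2) / 2" unfolding \<epsilon>_def using a by simp
    moreover have "a + e - (a + e - 2) / 2 = 2 + \<delta>" unfolding \<delta>_def by (simp add: field_simps)
    ultimately show ?thesis by (simp only:)
  qed
  show ?thesis
    unfolding Let_def
  proof (rule exI[of _ \<epsilon>], rule conjI[OF \<epsilon>], rule exI[of _ \<delta>], rule conjI[OF \<delta>],
      rule exI[of _ "3 powr \<bar>e\<bar>"], intro conjI ballI)
    show "(0::real) < 3 powr \<bar>e\<bar>" by simp
    fix t y :: real assume "t \<in> {0..1}" "y \<in> {0<..<1}"
    then have t: "0 \<le> t" "t \<le> 1" and y: "0 < y" "y < 1" by auto
    have [measurable]: "(\<lambda>\<omega>. deriv (loewner_fhat (\<lambda>s. sqrt \<kappa> * B s \<omega>) t) (\<i> * of_real y)) \<in> borel_measurable M"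
      using y by (intro deriv_loewner_fhat_measurable t(1)) simp
    show "{\<omega> \<in> space M. norm (deriv (loewner_fhat (\<lambda>s. sqrt \<kappa> * B s \<omega>) t) (\<i> * of_real y)) > y powr (- (1 - \<epsilon>))} \<in> sets M"
      by measurable
    have "measure M {\<omega> \<in> space M. norm (deriv (loewner_fhat (\<lambda>s. sqrt \<kappa> * B s \<omega>) t) (\<i> * of_real y)) > y powr (- (1 - \<epsilon>))}
        \<le> 3 powr \<bar>e\<bar> * y powr (a + e - \<epsilon> * (a + \<bar>e\<bar>))"
      unfolding a_def e_def
      using deriv_loewner_fhat_tail[of \<kappa> b t y \<epsilon>] assms b t y \<epsilon> a unfolding a_def by simp
    then show "measure M {\<omega> \<in> space M. norm (deriv (loewner_fhat (\<lambda>s. sqrt \<kappa> * B s \<omega>) t) (\<i> * of_real y)) > y powr (- (1 - \<epsilon>))}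
        \<le> 3 powr \<bar>e\<bar> * y powr (2 + \<delta>)"
      unfolding ex .
  qed
qed

end
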